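(* Let $X$ be a finite alphabet, let $t\notin X$ be a further letter, and let $w\in(\overline{X}\cup\{t,t^{-1}\})^{\ast}$ be a word such that: (i) $w\equiv x_0^{\varepsilon_0}t^{n_1}x_1^{\varepsilon_1}\cdots t^{n_k}x_k^{\varepsilon_k}$, where $n_i\in\mathbb{Z}$ for $1\le i\le k$, $\varepsilon_i\in\{-1,1\}$ and $x_i\in X$ for $0\le i\le k$, and $x_i\not\equiv x_j,x_j^{-1}$ whenever $i\ne j$; (ii) $\sigma_t(w)=n_1+\cdots+n_k\neq 0$. Let $M=\mathrm{Inv}\langle X\cup\{t\}\mid wt^{-2\sigma_t(w)}w=1\rangle$ be an inverse monoid and let $G=\mathrm{Gp}\langle X\cup\{t\}\mid wt^{-2\sigma_t(w)}w=1\rangle$ be its maximal group image. Then both the prefix membership problem for $G$ (with respect to this presentation) and the word problem for $M$ are decidable.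
   Context: $\overline{X}=X\cup X^{-1}$; $\equiv$ denotes equality of words. $\sigma_t(w)$ is the exponent sum of $t$ in $w$: the number of occurrences of $t$ minus the number of occurrences of $t^{-1}$. $\mathrm{Gp}\langle Y\mid r=1\rangle$ is the group with generators $Y$ and defining relation $r=1$. $\mathrm{Inv}\langle Y\mid r=1\rangle$ is the inverse monoid presented by generators $Y$ and relation $r=1$: the quotient of the free monoid $\overline{Y}^{\ast}$ by the congruence generated by $uu^{-1}u=u$ and $uu^{-1}vv^{-1}=vv^{-1}uu^{-1}$ for all $u,v\in\overline{Y}^{\ast}$, together with $r=1$. For a word $r$, $\mathrm{pref}(r)$ is the set of all prefixes of $r$ (including the empty word and $r$). The prefix monoid of $G=\mathrm{Gp}\langle Y\mid r=1\rangle$ is the submonoid of $G$ generated by the elements represented by $\mathrm{pref}(r)$. The prefix membership problem for $G$ is decidable if there is an algorithm which, given a word over $\overline{Y}$, decides whether the element of $G$ it represents lies in the prefix monoid. The word problem for $M$ is decidable if there is an algorithm which, given two words over $\overline{Y}$, decides whether they represent the same element of $M$. *)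

theory Defs
  imports
    "HOL.Hull"
    "HOL-Algebra.Group"
    "HOL-Library.Sublist"
    "HOL-Library.Nat_Bijection"
begin

section \<open>Words\<close>

text \<open>The letter \<open>(y, True)\<close> stands for \<open>y\<close> and \<open>(y, False)\<close> for its formal inverse.\<close>

type_synonym 'a word = "('a \<times> bool) list"

definition words :: "'a set \<Rightarrow> 'a word set" where
  "words Y = lists (Y \<times> UNIV)"

definition inv_letter :: "'a \<times> bool \<Rightarrow> 'a \<times> bool" where
  "inv_letter a = (fst a, \<not> snd a)"

definition inv_word :: "'a word \<Rightarrow> 'a word" where
  "inv_word u = rev (map inv_letter u)"

definition letter_pow :: "'a \<Rightarrow> int \<Rightarrow> 'a word" where
  "letter_pow y m = replicate (nat \<bar>m\<bar>) (y, m \<ge> 0)"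

definition exp_sum :: "'a \<Rightarrow> 'a word \<Rightarrow> int" where
  "exp_sum y u = int (count_list u (y, True)) - int (count_list u (y, False))"


section \<open>Presentations\<close>

text \<open>The congruence on the free monoid \<open>words Y\<close> generated by \<open>R\<close>.\<close>

inductive_set cong_gen :: "'a set \<Rightarrow> ('a word \<times> 'a word) set \<Rightarrow> ('a word \<times> 'a word) set"
  for Y :: "'a set" and R :: "('a word \<times> 'a word) set" where
  base: "(u, v) \<in> R \<Longrightarrow> u \<in> words Y \<Longrightarrow> v \<in> words Y \<Longrightarrow> (u, v) \<in> cong_gen Y R"
| refl: "u \<in> words Y \<Longrightarrow> (u, u) \<in> cong_gen Y R"
| sym: "(u, v) \<in> cong_gen Y R \<Longrightarrow> (v, u) \<in> cong_gen Y R"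
| trans: "(u, v) \<in> cong_gen Y R \<Longrightarrow> (v, w) \<in> cong_gen Y R \<Longrightarrow> (u, w) \<in> cong_gen Y R"
| mult: "(u, v) \<in> cong_gen Y R \<Longrightarrow> (u', v') \<in> cong_gen Y R \<Longrightarrow> (u @ u', v @ v') \<in> cong_gen Y R"

text \<open>The element represented by the word \<open>u\<close> is its congruence class.\<close>

definition elem_of :: "'a set \<Rightarrow> ('a word \<times> 'a word) set \<Rightarrow> 'a word \<Rightarrow> 'a word set" where
  "elem_of Y R u = cong_gen Y R `` {u}"

definition presented_monoid :: "'a set \<Rightarrow> ('a word \<times> 'a word) set \<Rightarrow> 'a word set monoid" where
  "presented_monoid Y R =
     \<lparr>carrier = words Y // cong_gen Y R,
      mult = (\<lambda>P Q. \<Union>p\<in>P. \<Union>q\<in>Q. elem_of Y R (p @ q)),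
      one = elem_of Y R []\<rparr>"

text \<open>
  Defining relations of \<open>Gp\<langle>Y | r = 1\<rangle>\<close> and of \<open>Inv\<langle>Y | r = 1\<rangle>\<close> as monoids.
  As \<open>a\<close> ranges over all letters, \<open>gp_rels\<close> contains both \<open>y y\<inverse> = 1\<close> and \<open>y\<inverse> y = 1\<close>.
\<close>

definition gp_rels :: "'a set \<Rightarrow> 'a word \<Rightarrow> ('a word \<times> 'a word) set" where
  "gp_rels Y r = {([a, inv_letter a], []) | a. a \<in> Y \<times> UNIV} \<union> {(r, [])}"

definition inv_rels :: "'a set \<Rightarrow> 'a word \<Rightarrow> ('a word \<times> 'a word) set" where
  "inv_rels Y r =
     {(u @ inv_word u @ u, u) | u. u \<in> words Y} \<union>
     {(u @ inv_word u @ v @ inv_word v, v @ inv_word v @ u @ inv_word u) | u v.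
        u \<in> words Y \<and> v \<in> words Y} \<union>
     {(r, [])}"

abbreviation Gp :: "'a set \<Rightarrow> 'a word \<Rightarrow> 'a word set monoid" where
  "Gp Y r \<equiv> presented_monoid Y (gp_rels Y r)"

text \<open>Multiplication is well defined on classes, and \<open>Gp Y r\<close> is a group.\<close>

lemma cong_gen_words: "(u, v) \<in> cong_gen Y R \<Longrightarrow> u \<in> words Y \<and> v \<in> words Y"
  by (induction rule: cong_gen.induct) (auto simp: words_def)

lemma elem_of_eq_iff:
  assumes "u \<in> words Y"
  shows "elem_of Y R u = elem_of Y R v \<longleftrightarrow> (u, v) \<in> cong_gen Y R"
proof
  assume "elem_of Y R u = elem_of Y R v"
  moreover have "u \<in> elem_of Y R u"
    using assms by (simp add: elem_of_def cong_gen.refl)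
  ultimately have "(v, u) \<in> cong_gen Y R"
    by (simp add: elem_of_def)
  then show "(u, v) \<in> cong_gen Y R"
    by (rule cong_gen.sym)
next
  assume uv: "(u, v) \<in> cong_gen Y R"
  then have vu: "(v, u) \<in> cong_gen Y R"
    by (rule cong_gen.sym)
  have "(u, z) \<in> cong_gen Y R \<longleftrightarrow> (v, z) \<in> cong_gen Y R" for z
    using cong_gen.trans[OF uv, of z] cong_gen.trans[OF vu, of z] by blast
  then show "elem_of Y R u = elem_of Y R v"
    by (auto simp: elem_of_def)
qed

lemma carrier_presented_monoid: "carrier (presented_monoid Y R) = elem_of Y R ` words Y"
  by (auto simp: presented_monoid_def elem_of_def quotient_def)

lemma mult_elem_of:
  assumes "u \<in> words Y" "v \<in> words Y"
  shows "elem_of Y R u \<otimes>\<^bsub>presented_monoid Y R\<^esub> elem_of Y R v = elem_of Y R (u @ v)"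
proof -
  have *: "elem_of Y R (p @ q) = elem_of Y R (u @ v)"
    if "p \<in> elem_of Y R u" "q \<in> elem_of Y R v" for p q
  proof -
    have "(u @ v, p @ q) \<in> cong_gen Y R"
      using that by (auto simp: elem_of_def intro: cong_gen.mult)
    moreover have "u @ v \<in> words Y"
      using assms by (simp add: words_def)
    ultimately show ?thesis
      using elem_of_eq_iff[of "u @ v" Y R "p @ q"] by simp
  qed
  have uv: "u \<in> elem_of Y R u" "v \<in> elem_of Y R v"
    using assms by (auto simp: elem_of_def intro: cong_gen.refl)
  have UN: "(\<Union>p\<in>A. \<Union>q\<in>B. f p q) = c"
    if "a \<in> A" "b \<in> B" "\<And>p q. p \<in> A \<Longrightarrow> q \<in> B \<Longrightarrow> f p q = c"
    for A B :: "'b set" and f :: "'b \<Rightarrow> 'b \<Rightarrow> 'c set" and a b c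
    using that by fastforce
  have "(\<Union>p\<in>elem_of Y R u. \<Union>q\<in>elem_of Y R v. elem_of Y R (p @ q)) = elem_of Y R (u @ v)"
    using uv * by (rule UN)
  then show ?thesis
    by (simp add: presented_monoid_def)
qed

lemma monoid_presented_monoid: "monoid (presented_monoid Y R)"
proof -
  have one: "\<one>\<^bsub>presented_monoid Y R\<^esub> = elem_of Y R []"
    by (simp add: presented_monoid_def)
  have nil: "[] \<in> words Y" and app: "\<And>u v. u \<in> words Y \<Longrightarrow> v \<in> words Y \<Longrightarrow> u @ v \<in> words Y"
    by (simp_all add: words_def)
  show ?thesis
    by unfold_locales (auto simp: carrier_presented_monoid mult_elem_of one nil app)
qed

lemma group_Gp: "group (Gp Y r)"
proof -
  interpret monoid "Gp Y r"
    by (rule monoid_presented_monoid)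
  have one: "\<one>\<^bsub>Gp Y r\<^esub> = elem_of Y (gp_rels Y r) []"
    by (simp add: presented_monoid_def)
  have inv_words: "inv_word u \<in> words Y" if "u \<in> words Y" for u
    using that by (auto simp: words_def inv_word_def inv_letter_def lists_eq_set)
  have cancel: "(inv_word u @ u, []) \<in> cong_gen Y (gp_rels Y r)" if "u \<in> words Y" for u
    using that
  proof (induction u)
    case Nil
    then show ?case by (auto simp: inv_word_def words_def intro: cong_gen.refl)
  next
    case (Cons a u)
    let ?C = "cong_gen Y (gp_rels Y r)"
    have a: "a \<in> Y \<times> UNIV" and u: "u \<in> words Y"
      using Cons.prems by (auto simp: words_def)
    have a': "inv_letter a \<in> Y \<times> UNIV" and aa: "inv_letter (inv_letter a) = a"
      using a by (auto simp: inv_letter_def)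
    have "([inv_letter a, inv_letter (inv_letter a)], []) \<in> gp_rels Y r"
      unfolding gp_rels_def using a'
      by (intro UnI1 CollectI exI[of _ "inv_letter a"] conjI) simp_all
    then have "([inv_letter a, a], []) \<in> ?C"
      using a a' unfolding aa by (intro cong_gen.base) (simp_all add: words_def)
    then have "(inv_word u @ ([inv_letter a, a] @ u), inv_word u @ ([] @ u)) \<in> ?C"
      using u inv_words[OF u] by (intro cong_gen.mult cong_gen.refl)
    then have "(inv_word (a # u) @ a # u, inv_word u @ u) \<in> ?C"
      by (simp add: inv_word_def)
    then show ?case
      using Cons.IH[OF u] by (rule cong_gen.trans)
  qed
  show ?thesis
  proof (rule group_l_invI)
    fix g assume "g \<in> carrier (Gp Y r)"
    then obtain u where u: "u \<in> words Y" and g: "g = elem_of Y (gp_rels Y r) u"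
      by (auto simp: carrier_presented_monoid)
    have "elem_of Y (gp_rels Y r) (inv_word u) \<otimes>\<^bsub>Gp Y r\<^esub> g = elem_of Y (gp_rels Y r) (inv_word u @ u)"
      using u inv_words[OF u] by (simp add: g mult_elem_of)
    also have "\<dots> = \<one>\<^bsub>Gp Y r\<^esub>"
      using cancel[OF u] cong_gen_words[OF cancel[OF u]] by (simp add: one elem_of_eq_iff)
    finally show "\<exists>h\<in>carrier (Gp Y r). h \<otimes>\<^bsub>Gp Y r\<^esub> g = \<one>\<^bsub>Gp Y r\<^esub>"
      using inv_words[OF u] by (auto simp: carrier_presented_monoid)
  qed
qed

text \<open>\<open>hull\<close> takes the intersection of all submonoids containing the given elements.\<close>

definition prefix_monoid :: "'a set \<Rightarrow> 'a word \<Rightarrow> 'a word set set" where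
  "prefix_monoid Y r =
     (\<lambda>H. submonoid H (Gp Y r)) hull (elem_of Y (gp_rels Y r) ` {p. prefix p r})"


section \<open>Decidability\<close>

text \<open>
  \<open>recursive n f\<close>: the restriction of \<open>f\<close> to argument lists of length \<open>n\<close> is a (total) recursive
  function. Values on lists of other lengths are irrelevant. Minimisation is only applied to
  regular functions (those having a zero for all values of the parameters); by Kleene's normal
  form theorem this yields exactly the total functions among the partial recursive ones.
\<close>

inductive recursive :: "nat \<Rightarrow> (nat list \<Rightarrow> nat) \<Rightarrow> bool" where
  zero: "recursive n (\<lambda>xs. 0)"
| succ: "recursive 1 (\<lambda>xs. Suc (xs ! 0))"
| proj: "i < n \<Longrightarrow> recursive n (\<lambda>xs. xs ! i)"
| comp: "recursive (length gs) f \<Longrightarrow> (\<And>g. g \<in> set gs \<Longrightarrow> recursive n g) \<Longrightarrow>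
    recursive n (\<lambda>xs. f (map (\<lambda>g. g xs) gs))"
| prec: "recursive n f \<Longrightarrow> recursive (n + 2) g \<Longrightarrow>
    recursive (n + 1) (\<lambda>xs. rec_nat (f (tl xs)) (\<lambda>m v. g (m # v # tl xs)) (hd xs))"
| mini: "recursive (n + 1) f \<Longrightarrow> (\<And>xs. length xs = n \<Longrightarrow> \<exists>m. f (m # xs) = 0) \<Longrightarrow>
    recursive n (\<lambda>xs. LEAST m. f (m # xs) = 0)"

text \<open>Words are coded by natural numbers relative to a numbering \<open>c\<close> of the alphabet.\<close>

definition word_code :: "('a \<Rightarrow> nat) \<Rightarrow> 'a word \<Rightarrow> nat" where
  "word_code c u = list_encode (map (\<lambda>(y, b). 2 * c y + of_bool b) u)"

text \<open>
  Decidability of an \<open>n\<close>-ary relation between words over \<open>Y\<close>, for a finite alphabet \<open>Y\<close>. The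
  choice of the numbering is immaterial, since translating between two numberings of a finite
  set is recursive; we ask for a decision procedure for each of them.
\<close>

definition decidable_rel :: "'a set \<Rightarrow> nat \<Rightarrow> ('a word list \<Rightarrow> bool) \<Rightarrow> bool" where
  "decidable_rel Y n P \<longleftrightarrow>
     (\<forall>c. inj_on c Y \<longrightarrow>
       (\<exists>f. recursive n f \<and>
         (\<forall>us. length us = n \<and> set us \<subseteq> words Y \<longrightarrow>
            f (map (word_code c) us) = (if P us then 1 else 0))))"

definition prefix_membership_decidable :: "'a set \<Rightarrow> 'a word \<Rightarrow> bool" where
  "prefix_membership_decidable Y r \<longleftrightarrow>
     decidable_rel Y 1 (\<lambda>us. elem_of Y (gp_rels Y r) (us ! 0) \<in> prefix_monoid Y r)"

text \<open>
  The word problem of \<open>presented_monoid Y R\<close>: do two words represent the same element?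
\<close>

definition word_problem_decidable :: "'a set \<Rightarrow> ('a word \<times> 'a word) set \<Rightarrow> bool" where
  "word_problem_decidable Y R \<longleftrightarrow>
     decidable_rel Y 2 (\<lambda>us. elem_of Y R (us ! 0) = elem_of Y R (us ! 1))"

end

theory Submission
  imports Defs
begin

text \<open>
  Let \<open>p\<^sub>i\<close> be the prefix of \<open>w\<close> ending in \<open>x\<^sub>i\<close>, and let \<open>s = \<sigma>\<^sub>t(w)\<close>. The elements
  \<open>p\<^sub>0, \<dots>, p\<^sub>k = w\<close> and \<open>t\<close>, together with the letters that do not occur in \<open>w\<close>, form a basis of the free
  group, in which the relation reads \<open>w\<^sup>2 = t\<^bsup>2s\<^esup>\<close>. Hence \<open>G\<close> is the free product of
  \<open>H = \<langle>w, t | w\<^sup>2 = t\<^bsup>2s\<^esup>\<rangle>\<close> and a free group. Its prefix monoid \<open>P\<close> is generated by \<open>H\<close> and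
  \<open>p\<^sub>0, \<dots>, p\<^sub>k\<^sub>-\<^sub>1\<close>, so membership in \<open>P\<close> can be read off a normal form.

  The normal form of an element of \<open>G\<close> can be written as a word that lies above all words representing
  this element in the natural partial order of \<open>M\<close>; for a letter this word is equal to the letter
  in \<open>M\<close>. It follows that \<open>u = v\<close> in \<open>M\<close> if and only if \<open>u = v\<close> in \<open>G\<close> and \<open>U P = V P\<close>, where \<open>U\<close>
  and \<open>V\<close> are the sets of elements of \<open>G\<close> represented by the prefixes of \<open>u\<close> and of \<open>v\<close>.
\<close>

text \<open>Each \<open>x i\<close> occurs exactly once in \<open>w\<close>, so it can be traded for
  the prefix ending in it; this is why the listed elements form a basis. The normal forms are
  justified by van der Waerden's argument: the letters act on them so that the defining relations
  hold, and reading a normal form back as a word gives the converse. Modulo the central subgroup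
  generated by w^2 = t^(2s), H is a free product of two finite cyclic groups; the map to the
  integers is injective on that subgroup because s is nonzero. The obstacle is that cancelling
  changes the element of M. The elements w and t are units of M: w is both a prefix and a suffix of
  the relator, and t^(2s) = w^2. So only the free generators need care. For them a word and its
  normal form are compared by the natural order instead of equality, and the normal form is chosen
  as large as possible. Maximality of letters puts an edge into a Schuetzenberger graph as soon as
  both its ends are vertices, so the vertices and the value in G determine an element of M.\<close>

section \<open>Closure properties of the total recursive functions\<close>

definition rec_fun :: "nat \<Rightarrow> (nat list \<Rightarrow> nat) \<Rightarrow> bool" where
  "rec_fun n f \<longleftrightarrow> (\<exists>g. recursive n g \<and> (\<forall>xs. length xs = n \<longrightarrow> g xs = f xs))"

lemma rec_funI: "recursive n f \<Longrightarrow> rec_fun n f"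
  by (auto simp: rec_fun_def)

text \<open>\<open>recursive\<close> singles out functions whose values on lists of other lengths
  are accidental. Closing the class under agreement on lists of length \<open>n\<close> lets terms
  be rewritten freely.\<close>

lemma rec_fun_cong: "(\<And>xs. length xs = n \<Longrightarrow> f xs = g xs) \<Longrightarrow> rec_fun n f \<Longrightarrow> rec_fun n g"
  unfolding rec_fun_def by metis

lemma rec_fun_comp:
  assumes "rec_fun (length gs) f" "\<And>g. g \<in> set gs \<Longrightarrow> rec_fun n g"
  shows "rec_fun n (\<lambda>xs. f (map (\<lambda>g. g xs) gs))"
proof -
  obtain f' where f': "recursive (length gs) f'" "\<And>xs. length xs = length gs \<Longrightarrow> f' xs = f xs"
    using assms(1) by (auto simp: rec_fun_def)
  have "\<forall>g\<in>set gs. \<exists>g'. recursive n g' \<and> (\<forall>xs. length xs = n \<longrightarrow> g' xs = g xs)"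
    using assms(2) by (auto simp: rec_fun_def)
  then obtain G where G: "\<And>g. g \<in> set gs \<Longrightarrow> recursive n (G g) \<and> (\<forall>xs. length xs = n \<longrightarrow> G g xs = g xs)"
    by metis
  have "recursive n (\<lambda>xs. f' (map (\<lambda>g. g xs) (map G gs)))"
    by (rule recursive.comp) (use f'(1) G in auto)
  moreover have "f' (map (\<lambda>g. g xs) (map G gs)) = f (map (\<lambda>g. g xs) gs)" if "length xs = n" for xs
  proof -
    have "map (\<lambda>g. g xs) (map G gs) = map (\<lambda>g. g xs) gs"
      using G that by simp
    then show ?thesis
      by (simp only: f'(2) length_map)
  qed
  ultimately show ?thesis
    unfolding rec_fun_def by blast
qed

lemma rec_fun_comp1: "rec_fun 1 f \<Longrightarrow> rec_fun n g \<Longrightarrow> rec_fun n (\<lambda>xs. f [g xs])"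
  using rec_fun_comp[of "[g]" f n] by simp

lemma rec_fun_comp2:
  "rec_fun 2 f \<Longrightarrow> rec_fun n g \<Longrightarrow> rec_fun n h \<Longrightarrow> rec_fun n (\<lambda>xs. f [g xs, h xs])"
  using rec_fun_comp[of "[g, h]" f n] by (auto simp: numeral_2_eq_2)

lemma rec_fun_proj: "i < n \<Longrightarrow> rec_fun n (\<lambda>xs. xs ! i)"
  by (intro rec_funI recursive.proj)

lemma rec_fun_zero: "rec_fun n (\<lambda>xs. 0)"
  by (intro rec_funI recursive.zero)

lemma rec_fun_Suc: "rec_fun n f \<Longrightarrow> rec_fun n (\<lambda>xs. Suc (f xs))"
  using rec_fun_comp1[OF rec_funI[OF recursive.succ], of n f] by simp

lemma rec_fun_const: "rec_fun n (\<lambda>xs. m)"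
  by (induction m) (auto intro: rec_fun_zero rec_fun_Suc)

lemma rec_fun_prec:
  assumes "rec_fun n f" "rec_fun (n + 2) g"
  shows "rec_fun (n + 1) (\<lambda>xs. rec_nat (f (tl xs)) (\<lambda>m v. g (m # v # tl xs)) (hd xs))"
proof -
  obtain f' where f': "recursive n f'" "\<And>xs. length xs = n \<Longrightarrow> f' xs = f xs"
    using assms(1) by (auto simp: rec_fun_def)
  obtain g' where g': "recursive (n + 2) g'" "\<And>xs. length xs = n + 2 \<Longrightarrow> g' xs = g xs"
    using assms(2) by (auto simp: rec_fun_def)
  show ?thesis
    by (rule rec_fun_cong[OF _ rec_funI[OF recursive.prec[OF f'(1) g'(1)]]]) (simp add: f'(2) g'(2))
qed

lemma rec_fun_rec_nat:
  assumes "rec_fun 1 f" "rec_fun 3 g" "rec_fun n a" "rec_fun n b"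
  shows "rec_fun n (\<lambda>xs. rec_nat (f [b xs]) (\<lambda>m v. g [m, v, b xs]) (a xs))"
proof -
  have "rec_fun 2 (\<lambda>xs. rec_nat (f (tl xs)) (\<lambda>m v. g (m # v # tl xs)) (hd xs))"
    using rec_fun_prec[of 1 f g] assms(1,2) by (simp add: numeral_eq_Suc)
  from rec_fun_comp2[OF this assms(3,4)] show ?thesis
    by simp
qed

definition rec1 :: "(nat \<Rightarrow> nat) \<Rightarrow> bool" where
  "rec1 f \<longleftrightarrow> rec_fun 1 (\<lambda>xs. f (xs ! 0))"

definition rec2 :: "(nat \<Rightarrow> nat \<Rightarrow> nat) \<Rightarrow> bool" where
  "rec2 f \<longleftrightarrow> rec_fun 2 (\<lambda>xs. f (xs ! 0) (xs ! 1))"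

lemma rec_fun_app1: "rec1 f \<Longrightarrow> rec_fun n g \<Longrightarrow> rec_fun n (\<lambda>xs. f (g xs))"
  unfolding rec1_def by (drule rec_fun_comp1) auto

lemma rec_fun_app2: "rec2 f \<Longrightarrow> rec_fun n g \<Longrightarrow> rec_fun n h \<Longrightarrow> rec_fun n (\<lambda>xs. f (g xs) (h xs))"
  unfolding rec2_def by (drule rec_fun_comp2) auto

lemma rec1_app1: "rec1 f \<Longrightarrow> rec1 g \<Longrightarrow> rec1 (\<lambda>x. f (g x))"
  using rec_fun_app1[of f 1 "\<lambda>xs. g (xs ! 0)"] by (simp add: rec1_def)

lemma rec1_app2: "rec2 f \<Longrightarrow> rec1 g \<Longrightarrow> rec1 h \<Longrightarrow> rec1 (\<lambda>x. f (g x) (h x))"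
  using rec_fun_app2[of f 1 "\<lambda>xs. g (xs ! 0)" "\<lambda>xs. h (xs ! 0)"] by (simp add: rec1_def)

lemma rec1_id: "rec1 (\<lambda>x. x)"
  by (simp add: rec1_def rec_fun_proj)

lemma rec1_const: "rec1 (\<lambda>x. m)"
  by (simp add: rec1_def rec_fun_const)

lemma rec1_Suc: "rec1 f \<Longrightarrow> rec1 (\<lambda>x. Suc (f x))"
  by (simp add: rec1_def rec_fun_Suc)

lemma rec2_rec_nat:
  assumes "rec1 f" and g: "rec_fun 3 (\<lambda>xs. g (xs ! 0) (xs ! 1) (xs ! 2))"
  shows "rec2 (\<lambda>a b. rec_nat (f b) (\<lambda>m v. g m v b) a)"
  using rec_fun_rec_nat[OF assms(1)[unfolded rec1_def] g rec_fun_proj[of 0 2] rec_fun_proj[of 1 2]]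
  by (simp add: rec2_def)

lemma rec2_funpow:
  assumes "rec1 f"
  shows "rec2 (\<lambda>a b. (f ^^ a) b)"
proof -
  have "rec2 (\<lambda>a b. rec_nat b (\<lambda>m v. f v) a)"
    by (intro rec2_rec_nat rec1_id rec_fun_app1[OF assms] rec_fun_proj) simp
  moreover have "rec_nat b (\<lambda>m v. f v) a = (f ^^ a) b" for a b
    by (induction a) auto
  ultimately show ?thesis by simp
qed

lemma rec2_swap: "rec2 f \<Longrightarrow> rec2 (\<lambda>a b. f b a)"
  unfolding rec2_def[of "\<lambda>a b. f b a"] by (rule rec_fun_app2) (auto intro: rec_fun_proj)

lemma rec1_pred: "rec1 (\<lambda>x. x - 1)"
proof -
  have "rec2 (\<lambda>a b. rec_nat 0 (\<lambda>m v. m) a)"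
    by (intro rec2_rec_nat rec1_const rec_fun_proj) simp
  from rec1_app2[OF this rec1_id rec1_id] have "rec1 (\<lambda>x. rec_nat 0 (\<lambda>m v. m) x)" .
  moreover have "rec_nat 0 (\<lambda>m v. m) x = x - 1" for x :: nat
    by (cases x) auto
  ultimately show ?thesis by simp
qed

lemma rec2_add: "rec2 (+)"
proof -
  have "(Suc ^^ a) b = a + b" for a b
    by (induction a) auto
  with rec2_funpow[OF rec1_Suc[OF rec1_id]] show ?thesis by simp
qed

lemma rec2_diff: "rec2 (-)"
proof -
  have "((\<lambda>x. x - 1) ^^ a) b = b - a" for a b :: nat
    by (induction a) auto
  with rec2_swap[OF rec2_funpow[OF rec1_pred]] show ?thesis by simp
qed

text \<open>Primitive recursion whose step ignores the previous value is a test for zero.\<close>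

lemma rec1_if:
  assumes "rec1 b" "rec1 f" "rec1 g"
  shows "rec1 (\<lambda>x. if b x = 0 then g x else f x)"
proof -
  have "rec2 (\<lambda>a x. rec_nat (g x) (\<lambda>m v. f x) a)"
    by (intro rec2_rec_nat assms rec_fun_app1[OF assms(2)] rec_fun_proj) simp
  from rec1_app2[OF this assms(1) rec1_id] have "rec1 (\<lambda>x. rec_nat (g x) (\<lambda>m v. f x) (b x))" .
  moreover have "rec_nat (g x) (\<lambda>m v. f x) (b x) = (if b x = 0 then g x else f x)" for x
    by (cases "b x") auto
  ultimately show ?thesis by simp
qed

lemma rec1_triangle: "rec1 triangle"
proof -
  have "rec2 (\<lambda>a b. rec_nat 0 (\<lambda>m v. v + Suc m) a)"
    by (intro rec2_rec_nat rec1_const rec_fun_app2[OF rec2_add] rec_fun_Suc rec_fun_proj) simp_all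
  from rec1_app2[OF this rec1_id rec1_id] have "rec1 (\<lambda>x. rec_nat 0 (\<lambda>m v. v + Suc m) x)" .
  moreover have "rec_nat 0 (\<lambda>m v. v + Suc m) x = triangle x" for x :: nat
    by (induction x) auto
  ultimately show ?thesis by simp
qed

lemma rec2_prod_encode: "rec2 (\<lambda>a b. prod_encode (a, b))"
  unfolding rec2_def prod_encode_def
  by (auto intro!: rec_fun_app2[OF rec2_add] rec_fun_app1[OF rec1_triangle] rec_fun_proj)

lemma triangle_mono: "m \<le> n \<Longrightarrow> triangle m \<le> triangle n"
  by (induction n) (auto simp: le_Suc_eq)

text \<open>The pair \<open>(a, b)\<close> is coded by \<open>triangle (a + b) + a\<close>, which
  lies below \<open>triangle (Suc d)\<close> exactly for \<open>d \<ge> a + b\<close>. Truncated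
  subtraction expresses this as a zero, the form in which minimisation finds the diagonal.\<close>

lemma diagonal_prod_encode: "(LEAST d. Suc (prod_encode (a, b)) - triangle (Suc d) = 0) = a + b"
proof (rule Least_equality)
  show "Suc (prod_encode (a, b)) - triangle (Suc (a + b)) = 0"
    by (simp add: prod_encode_def)
next
  fix d assume d: "Suc (prod_encode (a, b)) - triangle (Suc d) = 0"
  show "a + b \<le> d"
  proof (rule ccontr)
    assume "\<not> a + b \<le> d"
    then have "triangle (Suc d) \<le> triangle (a + b)"
      by (intro triangle_mono) simp
    with d show False
      by (simp add: prod_encode_def)
  qed
qed

definition diagonal :: "nat \<Rightarrow> nat" where
  "diagonal x = (LEAST d. Suc x - triangle (Suc d) = 0)"

lemma diagonal: "diagonal x = fst (prod_decode x) + snd (prod_decode x)"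
  unfolding diagonal_def using diagonal_prod_encode[of "fst (prod_decode x)" "snd (prod_decode x)"] by simp

lemma rec1_diagonal: "rec1 diagonal"
proof -
  have "rec_fun 2 (\<lambda>xs. Suc (xs ! 1) - triangle (Suc (xs ! 0)))"
    by (intro rec_fun_app2[OF rec2_diff] rec_fun_app1[OF rec1_triangle] rec_fun_Suc rec_fun_proj) auto
  then obtain f where f: "recursive (1 + 1) f"
    "\<And>xs. length xs = 2 \<Longrightarrow> f xs = Suc (xs ! 1) - triangle (Suc (xs ! 0))"
    by (auto simp: rec_fun_def numeral_2_eq_2)
  have "recursive 1 (\<lambda>xs. LEAST m. f (m # xs) = 0)"
  proof (rule recursive.mini[OF f(1)])
    fix xs :: "nat list" assume "length xs = 1"
    \<comment> \<open>Since \<open>Suc x \<le> triangle (Suc x)\<close>, the argument itself bounds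
      the search.\<close>
    then have "f (xs ! 0 # xs) = 0"
      by (simp add: f(2))
    then show "\<exists>m. f (m # xs) = 0" ..
  qed
  then show ?thesis
    unfolding rec1_def by (intro rec_fun_cong[OF _ rec_funI]) (auto simp: f(2) diagonal_def)
qed

lemma rec1_fst: "rec1 (\<lambda>x. fst (prod_decode x))"
proof -
  have "x - triangle (diagonal x) = fst (prod_decode x)" for x
    using prod_decode_inverse[of x] unfolding diagonal
    by (cases "prod_decode x") (auto simp: prod_encode_def)
  moreover have "rec1 (\<lambda>x. x - triangle (diagonal x))"
    by (intro rec1_app2[OF rec2_diff] rec1_app1[OF rec1_triangle] rec1_diagonal rec1_id)
  ultimately show ?thesis by simp
qed

lemma rec1_snd: "rec1 (\<lambda>x. snd (prod_decode x))"
proof -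
  have "diagonal x - fst (prod_decode x) = snd (prod_decode x)" for x
    by (simp add: diagonal)
  moreover have "rec1 (\<lambda>x. diagonal x - fst (prod_decode x))"
    by (intro rec1_app2[OF rec2_diff] rec1_diagonal rec1_fst)
  ultimately show ?thesis by simp
qed

section \<open>Computable functions between encodable types\<close>

class encodable =
  fixes enc :: "'a \<Rightarrow> nat"
  assumes inj_enc: "inj enc"

lemma enc_eq_iff [simp]: "enc x = enc y \<longleftrightarrow> x = y"
  using inj_enc by (auto dest: injD)

instantiation nat :: encodable
begin
definition enc_nat :: "nat \<Rightarrow> nat" where "enc_nat n = n"
instance by standard (auto simp: enc_nat_def inj_def)
end

instantiation bool :: encodable
begin
definition enc_bool :: "bool \<Rightarrow> nat" where "enc_bool b = of_bool b"
instance by standard (auto simp: enc_bool_def inj_def)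
end

text \<open>One of the two components is always \<open>0\<close>, so adding or subtracting
  \<open>1\<close> is a test for zero on codes followed by a successor or a predecessor.\<close>

instantiation int :: encodable
begin
definition enc_int :: "int \<Rightarrow> nat" where "enc_int i = prod_encode (nat i, nat (- i))"
instance by standard (auto simp: enc_int_def inj_def)
end

instantiation prod :: (encodable, encodable) encodable
begin
definition enc_prod :: "'a \<times> 'b \<Rightarrow> nat" where "enc_prod p = prod_encode (enc (fst p), enc (snd p))"
instance by standard (auto simp: enc_prod_def inj_def)
end

text \<open>As \<open>enc\<close> is the identity on numbers, this choice makes
  \<open>word_code c u\<close> the \<open>enc\<close> of a list of numbers.\<close>

instantiation list :: (encodable) encodable
begin
definition enc_list :: "'a list \<Rightarrow> nat" where "enc_list l = list_encode (map enc l)"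
instance by standard (auto simp: enc_list_def inj_def list_encode_eq inj_map_eq_map[OF inj_enc])
end

text \<open>Only the values of \<open>F\<close> on codes are prescribed, so nothing has to be
  recognised as a code.\<close>

definition computable :: "('a::encodable \<Rightarrow> 'b::encodable) \<Rightarrow> bool" where
  "computable f \<longleftrightarrow> (\<exists>F. rec1 F \<and> (\<forall>x. F (enc x) = enc (f x)))"

lemma computableI: "rec1 F \<Longrightarrow> (\<And>x. F (enc x) = enc (f x)) \<Longrightarrow> computable f"
  by (auto simp: computable_def)

lemma computable_comp: "computable f \<Longrightarrow> computable g \<Longrightarrow> computable (\<lambda>x. f (g x))"
  unfolding computable_def by (metis rec1_app1)

named_theorems computable_intros

lemma computable_id [computable_intros]: "computable (\<lambda>x. x)"
  by (rule computableI[OF rec1_id]) simp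

lemma computable_const [computable_intros]: "computable (\<lambda>x. c)"
  by (rule computableI[OF rec1_const]) simp

lemma computable_enc: "computable (enc :: 'a::encodable \<Rightarrow> nat)"
  by (rule computableI[OF rec1_id]) (simp add: enc_nat_def)

lemma computable_Suc [computable_intros]: "computable f \<Longrightarrow> computable (\<lambda>x. Suc (f x))"
  by (rule computable_comp[of Suc], rule computableI[OF rec1_Suc[OF rec1_id]])
    (simp_all add: enc_nat_def)

lemma computable_pred [computable_intros]: "computable f \<Longrightarrow> computable (\<lambda>x. f x - (1::nat))"
  by (rule computable_comp[of "\<lambda>x. x - 1"], rule computableI[OF rec1_pred])
    (simp_all add: enc_nat_def)

lemma computable_Pair [computable_intros]:
  assumes "computable f" "computable g"
  shows "computable (\<lambda>x. (f x, g x))"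
proof -
  obtain F G where "rec1 F" "rec1 G" "\<And>x. F (enc x) = enc (f x)" "\<And>x. G (enc x) = enc (g x)"
    using assms by (auto simp: computable_def)
  then show ?thesis
    by (intro computableI[OF rec1_app2[OF rec2_prod_encode, of F G]]) (auto simp: enc_prod_def)
qed

lemma computable_fst [computable_intros]: "computable f \<Longrightarrow> computable (\<lambda>x. fst (f x))"
  by (rule computable_comp[of fst], rule computableI[OF rec1_fst]) (simp_all add: enc_prod_def)

lemma computable_snd [computable_intros]: "computable f \<Longrightarrow> computable (\<lambda>x. snd (f x))"
  by (rule computable_comp[of snd], rule computableI[OF rec1_snd]) (simp_all add: enc_prod_def)

lemma computable_if [computable_intros]:
  assumes "computable b" "computable f" "computable g"
  shows "computable (\<lambda>x. if b x then f x else g x)"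
proof -
  obtain B F G where "rec1 B" "rec1 F" "rec1 G" "\<And>x. B (enc x) = enc (b x)"
    "\<And>x. F (enc x) = enc (f x)" "\<And>x. G (enc x) = enc (g x)"
    using assms by (auto simp: computable_def)
  then show ?thesis
    by (intro computableI[OF rec1_if, of B F G]) (auto simp: enc_bool_def)
qed

lemma computable_eq [computable_intros]:
  assumes "computable f" "computable g"
  shows "computable (\<lambda>x. f x = g x)"
proof -
  obtain F G where FG: "rec1 F" "rec1 G" "\<And>x. F (enc x) = enc (f x)" "\<And>x. G (enc x) = enc (g x)"
    using assms by (auto simp: computable_def)
  have "rec1 (\<lambda>x. 1 - ((F x - G x) + (G x - F x)))"
    by (intro rec1_app2[OF rec2_diff] rec1_app2[OF rec2_add] rec1_const FG)
  moreover have "1 - ((a - b) + (b - a)) = of_bool (a = b)" for a b :: nat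
    by auto
  ultimately show ?thesis
    by (intro computableI) (auto simp: FG enc_bool_def)
qed

lemma computable_conj [computable_intros]:
  "computable f \<Longrightarrow> computable g \<Longrightarrow> computable (\<lambda>x. f x \<and> g x)"
proof -
  assume "computable f" "computable g"
  then have "computable (\<lambda>x. if f x then g x else False)"
    by (intro computable_intros)
  also have "(\<lambda>x. if f x then g x else False) = (\<lambda>x. f x \<and> g x)"
    by auto
  finally show ?thesis .
qed

lemma computable_disj [computable_intros]:
  "computable f \<Longrightarrow> computable g \<Longrightarrow> computable (\<lambda>x. f x \<or> g x)"
proof -
  assume "computable f" "computable g"
  then have "computable (\<lambda>x. if f x then True else g x)"
    by (intro computable_intros)
  also have "(\<lambda>x. if f x then True else g x) = (\<lambda>x. f x \<or> g x)"
    by auto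
  finally show ?thesis .
qed

lemma computable_not [computable_intros]: "computable f \<Longrightarrow> computable (\<lambda>x. \<not> f x)"
proof -
  assume "computable f"
  then have "computable (\<lambda>x. if f x then False else True)"
    by (intro computable_intros)
  also have "(\<lambda>x. if f x then False else True) = (\<lambda>x. \<not> f x)"
    by auto
  finally show ?thesis .
qed

lemma computable_Cons [computable_intros]:
  assumes "computable f" "computable g"
  shows "computable (\<lambda>x. f x # g x)"
proof -
  obtain F G where "rec1 F" "rec1 G" "\<And>x. F (enc x) = enc (f x)" "\<And>x. G (enc x) = enc (g x)"
    using assms by (auto simp: computable_def)
  then show ?thesis
    by (intro computableI[OF rec1_Suc[OF rec1_app2[OF rec2_prod_encode, of F G]]])
      (auto simp: enc_list_def)
qed

text \<open>The code of \<open>a # as\<close> is the successor of the code of the pair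
  \<open>(a, as)\<close>, so one predecessor yields both parts at once.\<close>

lemma computable_case_list [computable_intros]:
  assumes l: "computable l" and f: "computable f"
    and g: "computable (\<lambda>p. g (fst p) (fst (snd p)) (snd (snd p)))"
  shows "computable (\<lambda>x. case l x of [] \<Rightarrow> f x | a # as \<Rightarrow> g x a as)"
proof -
  obtain L F G where LFG: "rec1 L" "rec1 F" "rec1 G" "\<And>x. L (enc x) = enc (l x)"
    "\<And>x. F (enc x) = enc (f x)" "\<And>x a as. G (enc (x, a, as)) = enc (g x a as)"
    using l f computable_comp[OF g computable_id] unfolding computable_def by (metis fst_conv snd_conv)
  have "rec1 (\<lambda>x. if L x = 0 then F x else G (prod_encode (x, L x - 1)))"
    by (intro rec1_if rec1_app1[OF LFG(3)] rec1_app2[OF rec2_prod_encode] rec1_app1[OF rec1_pred]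
        rec1_id LFG)
  then show ?thesis
  proof (rule computableI)
    fix x
    show "(if L (enc x) = 0 then F (enc x) else G (prod_encode (enc x, L (enc x) - 1))) =
        enc (case l x of [] \<Rightarrow> f x | a # as \<Rightarrow> g x a as)"
      using LFG(6) by (cases "l x") (auto simp: LFG enc_list_def enc_prod_def)
  qed
qed

lemma computable_add1_int [computable_intros]:
  assumes "computable f"
  shows "computable (\<lambda>x. f x + (1::int))"
proof (rule computable_comp[of "\<lambda>i. i + 1", OF _ assms])
  let ?F = "\<lambda>x. if snd (prod_decode x) = 0 then prod_encode (Suc (fst (prod_decode x)), 0)
    else prod_encode (0, snd (prod_decode x) - 1)"
  have "rec1 ?F"
    by (intro rec1_if rec1_app2[OF rec2_prod_encode] rec1_Suc rec1_app1[OF rec1_pred]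
        rec1_fst rec1_snd rec1_const)
  then show "computable (\<lambda>i. i + (1::int))"
    by (rule computableI) (auto simp: enc_int_def nat_eq_iff nat_diff_distrib)
qed

lemma computable_diff1_int [computable_intros]:
  assumes "computable f"
  shows "computable (\<lambda>x. f x - (1::int))"
proof (rule computable_comp[of "\<lambda>i. i - 1", OF _ assms])
  let ?F = "\<lambda>x. if fst (prod_decode x) = 0 then prod_encode (0, Suc (snd (prod_decode x)))
    else prod_encode (fst (prod_decode x) - 1, 0)"
  have "rec1 ?F"
    by (intro rec1_if rec1_app2[OF rec2_prod_encode] rec1_Suc rec1_app1[OF rec1_pred]
        rec1_fst rec1_snd rec1_const)
  then show "computable (\<lambda>i. i - (1::int))"
    by (rule computableI) (auto simp: enc_int_def nat_eq_iff nat_diff_distrib)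
qed

lemma computable_funpow_const:
  fixes f :: "'a::encodable \<Rightarrow> 'a"
  shows "computable f \<Longrightarrow> computable (f ^^ m)"
  by (induction m) (auto simp: comp_def id_def intro: computable_id computable_comp)

lemma computable_funpow:
  fixes f :: "'a::encodable \<Rightarrow> 'a"
  assumes "computable f" "computable m" "computable g"
  shows "computable (\<lambda>x. (f ^^ m x) (g x))"
proof -
  obtain F M G where FMG: "rec1 F" "rec1 M" "rec1 G" "\<And>x. F (enc x) = enc (f x)"
    "\<And>x. M (enc x) = enc (m x)" "\<And>x. G (enc x) = enc (g x)"
    using assms by (auto simp: computable_def)
  have "(F ^^ n) (enc y) = enc ((f ^^ n) y)" for n y
    by (induction n) (auto simp: FMG)
  with FMG show ?thesis
    by (intro computableI[OF rec1_app2[OF rec2_funpow[OF FMG(1)], of M G]]) (auto simp: enc_nat_def)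
qed

lemma length_le_list_encode: "length l \<le> list_encode l"
proof (induction l)
  case (Cons a l)
  then show ?case
    using le_prod_encode_2[of "list_encode l" a] by simp
qed simp

text \<open>The fold is the iteration of one step on a state that carries the parameter, the
  accumulator and the rest of the list. The code of the list serves as the number of rounds: it is
  at least the length, and rounds on an empty rest change nothing.\<close>

lemma computable_foldl:
  assumes step: "computable (\<lambda>p. step (fst p) (fst (snd p)) (snd (snd p)))" and g: "computable g" and l: "computable l"
  shows "computable (\<lambda>x. foldl (step x) (g x) (l x))"
proof -
  define body where "body = (\<lambda>(x, s, l). case l of [] \<Rightarrow> (x, s, l) | a # l' \<Rightarrow> (x, step x s a, l'))"
  have "computable (\<lambda>p. case snd (snd p) of [] \<Rightarrow> p | a # l' \<Rightarrow> (fst p, step (fst p) (fst (snd p)) a, l'))"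
  proof -
    have "computable (\<lambda>q. step (fst (fst q)) (fst (snd (fst q))) (fst (snd q)))"
      using computable_comp[OF step, of "\<lambda>q. (fst (fst q), fst (snd (fst q)), fst (snd q))"]
      by (simp add: computable_intros)
    then show ?thesis
      by (intro computable_intros)
  qed
  also have "(\<lambda>p. case snd (snd p) of [] \<Rightarrow> p | a # l' \<Rightarrow> (fst p, step (fst p) (fst (snd p)) a, l')) = body"
    by (auto simp: body_def fun_eq_iff split: list.splits)
  finally have "computable body" .
  moreover have body: "(body ^^ n) (x, s, l) = (x, foldl (step x) s l, [])" if "length l \<le> n" for n x s l
    using that
  proof (induction l arbitrary: n s)
    case Nil
    have "(body ^^ n) (x, s, []) = (x, s, [])"
      by (induction n) (auto simp: body_def)
    then show ?case by simp
  next
    case (Cons a l)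
    then obtain n' where "n = Suc n'" "length l \<le> n'"
      by (cases n) auto
    with Cons.IH show ?case
      by (simp add: funpow_Suc_right body_def del: funpow.simps)
  qed
  ultimately have "computable (\<lambda>x. fst (snd ((body ^^ enc (l x)) (x, g x, l x))))"
    by (intro computable_intros computable_funpow computable_comp[OF computable_enc] g l)
  moreover have "length (l x) \<le> enc (l x)" for x
    using length_le_list_encode[of "map enc (l x)"] by (simp add: enc_list_def)
  ultimately show ?thesis
    by (simp add: body)
qed

lemma computable_rev_map:
  assumes f: "computable f" and l: "computable l"
  shows "computable (\<lambda>x. rev (map f (l x)))"
proof -
  have "foldl (\<lambda>as a. f a # as) bs as = rev (map f as) @ bs" for as bs
    by (induction as arbitrary: bs) auto
  then have "rev (map f (l x)) = foldl (\<lambda>as a. f a # as) [] (l x)" for x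
    by simp
  moreover have "computable (\<lambda>x. foldl (\<lambda>as a. f a # as) [] (l x))"
    by (intro computable_foldl computable_intros computable_comp[OF f] l)
  ultimately show ?thesis
    by simp
qed

lemma computable_list_all:
  assumes f: "computable (\<lambda>p. f (fst p) (snd p))" and l: "computable l"
  shows "computable (\<lambda>x. list_all (f x) (l x))"
proof -
  have "foldl (\<lambda>b a. b \<and> f x a) c as \<longleftrightarrow> c \<and> list_all (f x) as" for x c as
    by (induction as arbitrary: c) auto
  then have "list_all (f x) (l x) = foldl (\<lambda>b a. b \<and> f x a) True (l x)" for x
    by simp
  moreover have "computable (\<lambda>p. f (fst p) (snd (snd p)))"
    using computable_comp[OF f, of "\<lambda>p. (fst p, snd (snd p))"] by (simp add: computable_intros)
  then have "computable (\<lambda>x. foldl (\<lambda>b a. b \<and> f x a) True (l x))"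
    by (intro computable_foldl computable_intros l)
  ultimately show ?thesis
    by simp
qed

lemma computable_list_ex:
  assumes f: "computable (\<lambda>p. f (fst p) (snd p))" and l: "computable l"
  shows "computable (\<lambda>x. list_ex (f x) (l x))"
proof -
  have "list_ex (f x) (l x) \<longleftrightarrow> \<not> list_all (\<lambda>a. \<not> f x a) (l x)" for x
    by (simp add: list_ex_iff list_all_iff)
  moreover have "computable (\<lambda>x. \<not> list_all (\<lambda>a. \<not> f x a) (l x))"
    by (intro computable_list_all computable_not f l)
  ultimately show ?thesis
    by simp
qed

lemma computable_add_const: "computable f \<Longrightarrow> computable (\<lambda>x. f x + (i::int))"
proof (induction i rule: int_induct[where k = 0])
  case (step1 i)
  then show ?case
    using computable_add1_int[of "\<lambda>x. f x + i"] by (simp add: add.assoc)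
next
  case (step2 i)
  then show ?case
    using computable_diff1_int[of "\<lambda>x. f x + i"] by (simp add: add_diff_eq)
qed simp

lemma computable_less_const: "computable f \<Longrightarrow> computable (\<lambda>x. f x < (m::nat))"
proof (induction m)
  case 0
  show ?case
    by (simp add: computable_const)
next
  case (Suc m)
  then have "computable (\<lambda>x. f x < m \<or> f x = m)"
    by (intro computable_intros)
  then show ?case
    by (simp add: less_Suc_eq)
qed

lemma computable_append:
  assumes "computable f" "computable g"
  shows "computable (\<lambda>x. f x @ g x)"
proof -
  have "foldl (\<lambda>bs a. a # bs) cs as = rev as @ cs" for as cs :: "'b list"
    by (induction as arbitrary: cs) auto
  then have "f x @ g x = foldl (\<lambda>bs a. a # bs) (g x) (rev (map (\<lambda>a. a) (f x)))" for x
    by simp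
  moreover have "computable (\<lambda>x. foldl (\<lambda>bs a. a # bs) (g x) (rev (map (\<lambda>a. a) (f x))))"
    by (intro computable_foldl computable_rev_map computable_intros assms)
  ultimately show ?thesis
    by simp
qed

text \<open>Each prefix appears reversed, because the fold extends the current one by
  \<open>Cons\<close>.\<close>

definition rev_prefixes :: "'a list \<Rightarrow> 'a list list" where
  "rev_prefixes l = fst (foldl (\<lambda>s a. ((a # snd s) # fst s, a # snd s)) ([[]], []) l)"

lemma set_rev_prefixes: "set (rev_prefixes l) = rev ` {q. prefix q l}"
proof -
  let ?f = "\<lambda>s a. ((a # snd s) # fst s, a # snd s)"
  have snd: "snd (foldl ?f ([[]], []) l) = rev l" for l :: "'a list"
    by (induction l rule: rev_induct) auto
  show ?thesis
  proof (induction l rule: rev_induct)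
    case (snoc a l)
    have "{q. prefix q (l @ [a])} = insert (l @ [a]) {q. prefix q l}"
      by auto
    with snoc show ?case
      by (simp add: rev_prefixes_def snd)
  qed (simp add: rev_prefixes_def)
qed

lemma computable_rev_prefixes: "computable f \<Longrightarrow> computable (\<lambda>x. rev_prefixes (f x))"
  unfolding rev_prefixes_def
  by (intro computable_foldl computable_intros)

text \<open>Finiteness of the alphabet enters through this lemma: finitely many algorithms, one for
  each letter, are joined by a case distinction built into the program.\<close>

lemma computable_finite_cases:
  assumes "finite A" "\<And>a. a \<in> A \<Longrightarrow> computable (f a)"
  shows "\<exists>g. computable (\<lambda>p. g (fst p) (snd p)) \<and> (\<forall>a\<in>A. g a = f a)"
  using assms
proof (induction A)
  case empty
  show ?case
    by (intro exI[of _ "\<lambda>_ _. undefined"]) (simp add: computable_const)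
next
  case (insert b A)
  then obtain g where g: "computable (\<lambda>p. g (fst p) (snd p))" "\<forall>a\<in>A. g a = f a"
    by auto
  have "computable (\<lambda>p. if fst p = b then f b (snd p) else g (fst p) (snd p))"
    by (intro computable_intros computable_comp[OF insert.prems[OF insertI1]] g)
  then have "computable (\<lambda>p. (if fst p = b then f b else g (fst p)) (snd p))"
    by (simp add: if_distribR cong: if_cong)
  with g(2) insert.hyps(2) show ?case
    by (intro exI[of _ "\<lambda>a. if a = b then f b else g a"]) auto
qed

lemma computable_recursive1:
  assumes "computable (P :: 'a::encodable \<Rightarrow> bool)"
  shows "\<exists>f. recursive 1 f \<and> (\<forall>x. f [enc x] = (if P x then 1 else 0))"
proof -
  obtain F where "rec1 F" "\<And>x. F (enc x) = enc (P x)"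
    using assms by (auto simp: computable_def)
  then show ?thesis
    by (fastforce simp: rec1_def rec_fun_def enc_bool_def)
qed

lemma computable_recursive2:
  assumes "computable (P :: 'a::encodable \<times> 'b::encodable \<Rightarrow> bool)"
  shows "\<exists>f. recursive 2 f \<and> (\<forall>x y. f [enc x, enc y] = (if P (x, y) then 1 else 0))"
proof -
  obtain F where F: "rec1 F" "\<And>p. F (enc p) = enc (P p)"
    using assms by (auto simp: computable_def)
  have "rec_fun 2 (\<lambda>xs. F (prod_encode (xs ! 0, xs ! 1)))"
    by (intro rec_fun_app1[OF F(1)] rec_fun_app2[OF rec2_prod_encode] rec_fun_proj) auto
  then obtain f where "recursive 2 f" "\<And>xs. length xs = 2 \<Longrightarrow> f xs = F (prod_encode (xs ! 0, xs ! 1))"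
    by (auto simp: rec_fun_def)
  moreover have "F (prod_encode (enc x, enc y)) = enc (P (x, y))" for x y
    using F(2)[of "(x, y)"] by (simp add: enc_prod_def)
  ultimately show ?thesis
    by (intro exI[of _ f]) (auto simp: enc_bool_def)
qed

section \<open>Formal inverses of words\<close>

lemma inv_letter_inv_letter [simp]: "inv_letter (inv_letter a) = a"
  by (simp add: inv_letter_def)

lemma inv_word_Nil [simp]: "inv_word [] = []"
  by (simp add: inv_word_def)

lemma inv_word_append [simp]: "inv_word (u @ v) = inv_word v @ inv_word u"
  by (simp add: inv_word_def)

lemma inv_word_Cons: "inv_word (a # u) = inv_word u @ [inv_letter a]"
  by (simp add: inv_word_def)

lemma inv_word_inv_word [simp]: "inv_word (inv_word u) = u"
  by (induction u) (simp_all add: inv_word_Cons)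

lemma words_append [simp]: "u @ v \<in> words Y \<longleftrightarrow> u \<in> words Y \<and> v \<in> words Y"
  by (auto simp: words_def)

lemma words_Nil [simp]: "[] \<in> words Y"
  by (simp add: words_def)

lemma words_Cons [simp]: "a # u \<in> words Y \<longleftrightarrow> fst a \<in> Y \<and> u \<in> words Y"
  by (cases a) (auto simp: words_def)

lemma words_inv_word [simp]: "inv_word u \<in> words Y \<longleftrightarrow> u \<in> words Y"
  by (induction u) (auto simp: inv_word_Cons inv_letter_def)

section \<open>Inverse monoids generated by words\<close>

text \<open>Only the image of \<open>\<phi>\<close> has to be an inverse monoid, with
  \<open>\<phi> (inv_word u)\<close> as the inverse of \<open>\<phi> u\<close>; the surrounding
  monoid is arbitrary. So a quotient can be studied inside a larger type.\<close>

locale inverse_monoid_hom =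
  fixes \<phi> :: "'a word \<Rightarrow> 'm::monoid_mult"
  assumes hom_append: "\<phi> (u @ v) = \<phi> u * \<phi> v"
    and hom_Nil: "\<phi> [] = 1"
    and regular: "\<phi> u * (\<phi> (inv_word u) * \<phi> u) = \<phi> u"
    and idem_commute: "\<phi> u * (\<phi> (inv_word u) * (\<phi> v * \<phi> (inv_word v))) =
      \<phi> v * (\<phi> (inv_word v) * (\<phi> u * \<phi> (inv_word u)))"
begin

lemma regular': "\<phi> (inv_word u) * (\<phi> u * \<phi> (inv_word u)) = \<phi> (inv_word u)"
  using regular[of "inv_word u"] by simp

lemma regular_left: "\<phi> u * (\<phi> (inv_word u) * (\<phi> u * x)) = \<phi> u * x"
  using arg_cong[OF regular[of u], of "\<lambda>y. y * x"] by (simp add: mult.assoc)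

lemma regular'_left: "\<phi> (inv_word u) * (\<phi> u * (\<phi> (inv_word u) * x)) = \<phi> (inv_word u) * x"
  using regular_left[of "inv_word u"] by simp

lemma idem_commute_left: "\<phi> u * (\<phi> (inv_word u) * (\<phi> v * (\<phi> (inv_word v) * x))) =
    \<phi> v * (\<phi> (inv_word v) * (\<phi> u * (\<phi> (inv_word u) * x)))"
  using arg_cong[OF idem_commute[of u v], of "\<lambda>y. y * x"] by (simp add: mult.assoc)

text \<open>Let e' be the inverse of e. As e'e and ee' commute, e' = e'eee' = ee'e'e. Substituting
  this into e = ee'e and using ee = e gives e = e'.\<close>

lemma idempotent_eq:
  assumes "\<phi> e * \<phi> e = \<phi> e"
  shows "\<phi> e * \<phi> (inv_word e) = \<phi> e"
proof -
  have ee: "\<phi> e * (\<phi> e * x) = \<phi> e * x" for x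
    using assms by (metis mult.assoc)
  have "\<phi> (inv_word e) = \<phi> (inv_word e) * (\<phi> e * (\<phi> e * \<phi> (inv_word e)))"
    by (simp only: ee regular')
  also have "\<dots> = \<phi> e * (\<phi> (inv_word e) * (\<phi> (inv_word e) * \<phi> e))"
    using idem_commute[of "inv_word e" e] by simp
  finally have e': "\<phi> (inv_word e) = \<phi> e * (\<phi> (inv_word e) * (\<phi> (inv_word e) * \<phi> e))" .
  have "\<phi> e = \<phi> e * (\<phi> (inv_word e) * \<phi> e)"
    by (simp only: regular)
  also have "\<dots> = \<phi> e * ((\<phi> e * (\<phi> (inv_word e) * (\<phi> (inv_word e) * \<phi> e))) * \<phi> e)"
    using e' by simp
  also have "\<dots> = \<phi> e * (\<phi> (inv_word e) * (\<phi> (inv_word e) * \<phi> e))"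
    by (simp only: mult.assoc ee assms)
  also have "\<dots> = \<phi> (inv_word e)"
    by (rule e'[symmetric])
  finally show ?thesis
    using assms by simp
qed

text \<open>The usual argument from commuting idempotents: with u' the inverse of u, commuting vu
  with u'u and uv with uu' shows that both v and u' are equal to u'uv.\<close>

lemma inverse_unique:
  assumes u: "\<phi> u * (\<phi> v * \<phi> u) = \<phi> u" and v: "\<phi> v * (\<phi> u * \<phi> v) = \<phi> v"
  shows "\<phi> v = \<phi> (inv_word u)"
proof -
  have vu: "\<phi> (v @ u) * \<phi> (inv_word (v @ u)) = \<phi> (v @ u)"
    and uv: "\<phi> (u @ v) * \<phi> (inv_word (u @ v)) = \<phi> (u @ v)"
    using u v by (intro idempotent_eq; simp add: hom_append mult.assoc)+
  have "\<phi> v = \<phi> (v @ u) * (\<phi> (inv_word u) * \<phi> (inv_word (inv_word u))) * \<phi> v"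
    using v by (simp add: hom_append mult.assoc regular_left)
  also have "\<phi> (v @ u) * (\<phi> (inv_word u) * \<phi> (inv_word (inv_word u))) =
      (\<phi> (inv_word u) * \<phi> (inv_word (inv_word u))) * \<phi> (v @ u)"
    using idem_commute[of "v @ u" "inv_word u"] vu by (metis mult.assoc)
  also have "\<dots> * \<phi> v = \<phi> (inv_word u) * (\<phi> u * \<phi> v)"
    using v by (simp add: hom_append mult.assoc)
  finally have "\<phi> v = \<phi> (inv_word u) * (\<phi> u * \<phi> v)" .
  moreover have "\<phi> (inv_word u) = \<phi> (inv_word u) * (\<phi> (u @ v) * (\<phi> u * \<phi> (inv_word u)))"
    using arg_cong[OF u, of "\<lambda>x. \<phi> (inv_word u) * (x * \<phi> (inv_word u))"]
    by (simp add: hom_append mult.assoc regular')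
  moreover have "\<phi> (u @ v) * (\<phi> u * \<phi> (inv_word u)) = (\<phi> u * \<phi> (inv_word u)) * \<phi> (u @ v)"
    using idem_commute[of "u @ v" u] uv by (metis mult.assoc)
  ultimately show ?thesis
    by (simp add: hom_append mult.assoc regular'_left)
qed

lemma inv_word_cong: "\<phi> u = \<phi> v \<Longrightarrow> \<phi> (inv_word u) = \<phi> (inv_word v)"
  using inverse_unique[of v "inv_word u"] regular[of u] regular'[of u] by simp

lemma right_unit:
  assumes "\<phi> u * x = 1"
  shows "\<phi> u * \<phi> (inv_word u) = 1"
proof -
  have "\<phi> u * \<phi> (inv_word u) = \<phi> u * (\<phi> (inv_word u) * (\<phi> u * x))"
    using assms by simp
  also have "\<dots> = \<phi> u * x"
    by (rule regular_left)
  finally show ?thesis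
    using assms by simp
qed

lemma left_unit:
  assumes "x * \<phi> u = 1"
  shows "\<phi> (inv_word u) * \<phi> u = 1"
proof -
  have "\<phi> (inv_word u) * \<phi> u = x * \<phi> u * \<phi> (inv_word u) * \<phi> u"
    using assms by simp
  also have "\<dots> = x * \<phi> u"
    by (simp add: mult.assoc regular)
  finally show ?thesis
    using assms by simp
qed

text \<open>The natural partial order, with the idempotent of \<open>u\<close> as canonical witness;
  by \<open>leI\<close> the idempotent of any word may serve instead.\<close>

definition le :: "'a word \<Rightarrow> 'a word \<Rightarrow> bool" (infix "\<preceq>" 50) where
  "u \<preceq> v \<longleftrightarrow> \<phi> u = \<phi> u * (\<phi> (inv_word u) * \<phi> v)"

lemma leI:
  assumes "\<phi> u = \<phi> z * (\<phi> (inv_word z) * \<phi> v)"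
  shows "u \<preceq> v"
proof -
  have "\<phi> u = \<phi> z * (\<phi> (inv_word z) * \<phi> u)"
    using assms by (simp add: regular_left)
  have "\<phi> u * (\<phi> (inv_word u) * \<phi> v) = (\<phi> z * (\<phi> (inv_word z) * \<phi> u)) * (\<phi> (inv_word u) * \<phi> v)"
    using assms by (simp add: regular_left)
  also have "\<dots> = \<phi> u * (\<phi> (inv_word u) * (\<phi> z * (\<phi> (inv_word z) * \<phi> v)))"
    by (simp add: mult.assoc idem_commute_left)
  also have "\<dots> = \<phi> u"
    using assms by (metis regular)
  finally show ?thesis
    by (simp add: le_def)
qed

lemma le_if_eq: "\<phi> u = \<phi> v \<Longrightarrow> u \<preceq> v"
  by (intro leI[of _ "[]"]) (simp add: hom_Nil)

lemma le_refl [simp]: "u \<preceq> u"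
  by (rule le_if_eq) simp

lemma le_trans [trans]:
  assumes "u \<preceq> v" "v \<preceq> w"
  shows "u \<preceq> w"
\<comment> \<open>The idempotent of this word is the product of the idempotents of \<open>u\<close>
  and \<open>v\<close>, which witness the two inequalities.\<close>
proof (rule leI[of _ "u @ inv_word u @ v"])
  have "\<phi> u = \<phi> u * (\<phi> (inv_word u) * (\<phi> v * (\<phi> (inv_word v) * \<phi> w)))"
    using assms by (metis le_def)
  also have "\<dots> = \<phi> (u @ inv_word u @ v) * (\<phi> (inv_word (u @ inv_word u @ v)) * \<phi> w)"
    by (simp add: hom_append mult.assoc idem_commute_left regular_left)
  finally show "\<phi> u = \<dots>" .
qed

lemma le_append_right:
  assumes "u \<preceq> v"
  shows "u @ w \<preceq> v @ w"
proof (rule leI[of _ u])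
  have "\<phi> (u @ w) = (\<phi> u * (\<phi> (inv_word u) * \<phi> v)) * \<phi> w"
    using assms by (simp add: le_def hom_append)
  then show "\<phi> (u @ w) = \<phi> u * (\<phi> (inv_word u) * \<phi> (v @ w))"
    by (simp only: hom_append mult.assoc)
qed

lemma le_append_left:
  assumes "u \<preceq> v"
  shows "w @ u \<preceq> w @ v"
proof (rule leI[of _ "w @ u"])
  have "\<phi> (w @ u) = \<phi> w * (\<phi> (inv_word w) * (\<phi> w * (\<phi> u * (\<phi> (inv_word u) * \<phi> v))))"
    using assms by (simp add: le_def hom_append regular_left)
  also have "\<dots> = \<phi> w * (\<phi> u * (\<phi> (inv_word u) * (\<phi> (inv_word w) * (\<phi> w * \<phi> v))))"
    using idem_commute_left[of "inv_word w" u "\<phi> v"] by simp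
  also have "\<dots> = \<phi> (w @ u) * (\<phi> (inv_word (w @ u)) * \<phi> (w @ v))"
    by (simp add: hom_append mult.assoc)
  finally show "\<phi> (w @ u) = \<dots>" .
qed

lemma le_Nil: "u @ inv_word u \<preceq> []" "inv_word u @ u \<preceq> []"
  by (rule leI[of _ u], simp add: hom_append hom_Nil)
    (rule leI[of _ "inv_word u"], simp add: hom_append hom_Nil)

lemma eq_le_trans: "\<phi> u = \<phi> v \<Longrightarrow> v \<preceq> w \<Longrightarrow> u \<preceq> w"
  by (rule le_trans[OF le_if_eq])

end

section \<open>The quotient of the free monoid by a congruence\<close>

text \<open>A Cayley representation. The quotient depends on \<open>Y\<close> and \<open>R\<close>,
  so it is not itself a type of class \<open>monoid_mult\<close>; its left translations live in the
  monoid of all maps on one fixed type.\<close>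

typedef 'b endo = "UNIV :: ('b \<Rightarrow> 'b) set" ..

setup_lifting type_definition_endo

instantiation endo :: (type) monoid_mult
begin
lift_definition one_endo :: "'b endo" is "\<lambda>x. x" .
lift_definition times_endo :: "'b endo \<Rightarrow> 'b endo \<Rightarrow> 'b endo" is "\<lambda>f g x. f (g x)" .
instance by standard (transfer; simp)+
end

text \<open>
  Being the identity off the classes makes it a homomorphism into the monoid of all maps.
\<close>

lift_definition left_transl :: "('b list \<Rightarrow> 'c) \<Rightarrow> 'b list \<Rightarrow> 'c endo" is
  "\<lambda>cls u x. if x \<in> range cls then cls (u @ (SOME v. cls v = x)) else x" .

context
  fixes cls :: "'b list \<Rightarrow> 'c"
  assumes cls_append: "\<And>u u' v v'. cls u = cls u' \<Longrightarrow> cls v = cls v' \<Longrightarrow> cls (u @ v) = cls (u' @ v')"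
begin

lemma left_transl_cls: "Rep_endo (left_transl cls u) (cls v) = cls (u @ v)"
  unfolding left_transl.rep_eq using someI[of "\<lambda>v'. cls v' = cls v" v] by (auto intro: cls_append)

lemma left_transl_append: "left_transl cls (u @ v) = left_transl cls u * left_transl cls v"
proof -
  have "Rep_endo (left_transl cls (u @ v)) x = Rep_endo (left_transl cls u) (Rep_endo (left_transl cls v) x)" for x
    by (cases "x \<in> range cls") (auto simp: left_transl_cls, auto simp: left_transl.rep_eq)
  then show ?thesis
    by (simp add: Rep_endo_inject[symmetric] times_endo.rep_eq fun_eq_iff)
qed

lemma left_transl_Nil: "left_transl cls [] = 1"
proof -
  have "Rep_endo (left_transl cls []) x = x" for x
    by (cases "x \<in> range cls") (auto simp: left_transl_cls, auto simp: left_transl.rep_eq)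
  then show ?thesis
    by (simp add: Rep_endo_inject[symmetric] one_endo.rep_eq fun_eq_iff)
qed

lemma left_transl_eq_iff: "left_transl cls u = left_transl cls v \<longleftrightarrow> cls u = cls v"
proof
  assume "left_transl cls u = left_transl cls v"
  then show "cls u = cls v"
    using left_transl_cls[of u "[]"] left_transl_cls[of v "[]"] by simp
next
  assume "cls u = cls v"
  then have "Rep_endo (left_transl cls u) x = Rep_endo (left_transl cls v) x" for x
    by (cases "x \<in> range cls") (auto simp: left_transl_cls intro: cls_append, auto simp: left_transl.rep_eq)
  then show "left_transl cls u = left_transl cls v"
    by (simp add: Rep_endo_inject[symmetric] fun_eq_iff)
qed

end

text \<open>Words with a foreign letter all have the empty class, and so has every word containing
  one of them. Hence \<open>elem_of\<close> is compatible with concatenation on all words, without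
  side conditions.\<close>

lemma elem_of_eq:
  "elem_of Y R u = elem_of Y R v \<longleftrightarrow> (u, v) \<in> cong_gen Y R \<or> u \<notin> words Y \<and> v \<notin> words Y"
proof (cases "u \<in> words Y \<or> v \<in> words Y")
  case True
  then show ?thesis
    using elem_of_eq_iff[of u Y R v] elem_of_eq_iff[of v Y R u] cong_gen.sym cong_gen_words by metis
next
  case False
  then have "elem_of Y R u = {}" "elem_of Y R v = {}"
    by (auto simp: elem_of_def dest: cong_gen_words)
  with False show ?thesis
    by auto
qed

lemma elem_of_append:
  assumes "elem_of Y R u = elem_of Y R u'" "elem_of Y R v = elem_of Y R v'"
  shows "elem_of Y R (u @ v) = elem_of Y R (u' @ v')"
  using assms unfolding elem_of_eq by (auto intro: cong_gen.mult dest: cong_gen_words)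

definition quot :: "'a set \<Rightarrow> ('a word \<times> 'a word) set \<Rightarrow> 'a word \<Rightarrow> 'a word set endo" where
  "quot Y R = left_transl (elem_of Y R)"

lemma quot_append: "quot Y R (u @ v) = quot Y R u * quot Y R v"
  unfolding quot_def by (rule left_transl_append) (rule elem_of_append)

lemma quot_Nil: "quot Y R [] = 1"
  unfolding quot_def by (rule left_transl_Nil) (rule elem_of_append)

lemma quot_eq_iff: "quot Y R u = quot Y R v \<longleftrightarrow> elem_of Y R u = elem_of Y R v"
  unfolding quot_def by (rule left_transl_eq_iff) (rule elem_of_append)

lemma quot_eqI: "(u, v) \<in> cong_gen Y R \<or> u \<notin> words Y \<and> v \<notin> words Y \<Longrightarrow> quot Y R u = quot Y R v"
  by (simp add: quot_eq_iff elem_of_eq)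

lemma quot_eqD: "quot Y R u = quot Y R v \<Longrightarrow> u \<in> words Y \<or> v \<in> words Y \<Longrightarrow> (u, v) \<in> cong_gen Y R"
  by (auto simp: quot_eq_iff elem_of_eq)

lemma quot_inv: "inverse_monoid_hom (quot Y (inv_rels Y r))"
proof
  fix u v
  let ?q = "quot Y (inv_rels Y r)"
  show "?q (u @ v) = ?q u * ?q v" by (rule quot_append)
  show "?q [] = 1" by (rule quot_Nil)
  have "(u @ inv_word u @ u, u) \<in> cong_gen Y (inv_rels Y r)" if "u \<in> words Y"
    using that by (intro cong_gen.base) (auto simp: inv_rels_def)
  then have "?q (u @ inv_word u @ u) = ?q u"
    by (intro quot_eqI) auto
  then show "?q u * (?q (inv_word u) * ?q u) = ?q u"
    by (simp add: quot_append)
  have "(u @ inv_word u @ v @ inv_word v, v @ inv_word v @ u @ inv_word u) \<in> cong_gen Y (inv_rels Y r)"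
    if "u \<in> words Y" "v \<in> words Y"
    using that by (intro cong_gen.base) (auto simp: inv_rels_def)
  then have "?q (u @ inv_word u @ v @ inv_word v) = ?q (v @ inv_word v @ u @ inv_word u)"
    by (intro quot_eqI) auto
  then show "?q u * (?q (inv_word u) * (?q v * ?q (inv_word v))) =
      ?q v * (?q (inv_word v) * (?q u * ?q (inv_word u)))"
    by (simp add: quot_append)
qed

lemma gp_cancel: "u \<in> words Y \<Longrightarrow> (u @ inv_word u, []) \<in> cong_gen Y (gp_rels Y r)"
proof (induction u rule: rev_induct)
  case (snoc a u)
  have "([a, inv_letter a], []) \<in> cong_gen Y (gp_rels Y r)"
    using snoc.prems by (intro cong_gen.base) (auto simp: gp_rels_def mem_Times_iff inv_letter_def)
  then have "(u @ ([a, inv_letter a] @ inv_word u), u @ ([] @ inv_word u)) \<in> cong_gen Y (gp_rels Y r)"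
    using snoc.prems by (intro cong_gen.mult cong_gen.refl) auto
  then have "((u @ [a]) @ inv_word (u @ [a]), u @ inv_word u) \<in> cong_gen Y (gp_rels Y r)"
    by (simp add: inv_word_Cons)
  then show ?case
    using snoc by (auto intro: cong_gen.trans)
qed (auto intro: cong_gen.refl)

lemma quot_gp_cancel:
  assumes "u \<in> words Y"
  shows "quot Y (gp_rels Y r) u * quot Y (gp_rels Y r) (inv_word u) = 1"
  using gp_cancel[OF assms] quot_eqI[of "u @ inv_word u" "[]" Y "gp_rels Y r"]
  by (simp add: quot_append quot_Nil)

lemma inv_cong_imp_gp_cong:
  assumes "(u, v) \<in> cong_gen Y (inv_rels Y r)"
  shows "(u, v) \<in> cong_gen Y (gp_rels Y r)"
  using assms
proof induction
  case (base u v)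
  let ?C = "cong_gen Y (gp_rels Y r)"
  from base(1) consider (reg) "u = v @ inv_word v @ v" | (comm) x y where
      "u = x @ inv_word x @ y @ inv_word y" "v = y @ inv_word y @ x @ inv_word x"
    | (rel) "u = r" "v = []"
    by (auto simp: inv_rels_def)
  then show ?case
  proof cases
    case reg
    have "((v @ inv_word v) @ v, [] @ v) \<in> ?C"
      using base by (intro cong_gen.mult gp_cancel cong_gen.refl)
    then show ?thesis
      by (simp add: reg)
  next
    case comm
    have "((x @ inv_word x) @ (y @ inv_word y), [] @ []) \<in> ?C"
      "((y @ inv_word y) @ (x @ inv_word x), [] @ []) \<in> ?C"
      using base comm by (intro cong_gen.mult gp_cancel; simp)+
    then show ?thesis
      using comm by (auto intro: cong_gen.sym cong_gen.trans)
  next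
    case rel
    with base show ?thesis
      by (intro cong_gen.base) (auto simp: gp_rels_def)
  qed
next
  case (trans u v w)
  then show ?case
    by (meson cong_gen.trans)
qed (auto intro: cong_gen.refl cong_gen.sym cong_gen.mult)

section \<open>Normal forms in the free product\<close>

text \<open>
  The group \<open>\<langle>w, t | w\<^sup>2 = t\<^bsup>2s\<^esup>\<rangle>\<close> embeds into the direct product of \<open>\<int>\<close>, by \<open>t \<mapsto> 1\<close> and \<open>w \<mapsto> s\<close>,
  and of the free product of the cyclic groups of order \<open>2\<close> and \<open>N = 2\<bar>s\<bar>\<close>. In the latter component
  a reduced word is a list with its last syllable first, in which \<open>0\<close> stands for \<open>w\<close> and
  \<open>0 < j < N\<close> for \<open>t\<^sup>j\<close>.
\<close>

type_synonym hstate = "int \<times> nat list"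

definition syll_w :: "nat list \<Rightarrow> nat list" where
  "syll_w l = (case l of [] \<Rightarrow> [0] | d # l' \<Rightarrow> if d = 0 then l' else 0 # l)"

definition syll_t :: "nat \<Rightarrow> nat list \<Rightarrow> nat list" where
  "syll_t N l = (case l of [] \<Rightarrow> [1] | d # l' \<Rightarrow>
     if d = 0 then 1 # l else if Suc d = N then l' else Suc d # l')"

definition syll_t_inv :: "nat \<Rightarrow> nat list \<Rightarrow> nat list" where
  "syll_t_inv N l = (case l of [] \<Rightarrow> [N - 1] | d # l' \<Rightarrow>
     if d = 0 then (N - 1) # l else if d = 1 then l' else (d - 1) # l')"

fun syll_valid :: "nat \<Rightarrow> nat list \<Rightarrow> bool" where
  "syll_valid N [] \<longleftrightarrow> True"
| "syll_valid N [d] \<longleftrightarrow> d < N"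
| "syll_valid N (d # d' # l) \<longleftrightarrow> d < N \<and> (d = 0) \<noteq> (d' = 0) \<and> syll_valid N (d' # l)"

lemma syll_valid_Cons:
  "syll_valid N (d # l) \<longleftrightarrow> d < N \<and> (l = [] \<or> (d = 0) \<noteq> (hd l = 0)) \<and> syll_valid N l"
  by (cases l) auto

lemma syll_w_valid: "syll_valid N l \<Longrightarrow> 2 \<le> N \<Longrightarrow> syll_valid N (syll_w l)"
  by (cases l) (auto simp: syll_w_def syll_valid_Cons)

lemma syll_w_w: "syll_valid N l \<Longrightarrow> syll_w (syll_w l) = l"
  by (cases l; cases "tl l") (auto simp: syll_w_def syll_valid_Cons)

lemma syll_t_valid: "syll_valid N l \<Longrightarrow> 2 \<le> N \<Longrightarrow> syll_valid N (syll_t N l)"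
  by (cases l) (auto simp: syll_t_def syll_valid_Cons)

lemma syll_t_inv_valid: "syll_valid N l \<Longrightarrow> 2 \<le> N \<Longrightarrow> syll_valid N (syll_t_inv N l)"
  by (cases l) (auto simp: syll_t_inv_def syll_valid_Cons)

lemma syll_t_t_inv: "syll_valid N l \<Longrightarrow> 2 \<le> N \<Longrightarrow> syll_t N (syll_t_inv N l) = l"
  by (cases l; cases "tl l") (auto simp: syll_t_def syll_t_inv_def syll_valid_Cons)

lemma syll_t_inv_t: "syll_valid N l \<Longrightarrow> 2 \<le> N \<Longrightarrow> syll_t_inv N (syll_t N l) = l"
  by (cases l; cases "tl l") (auto simp: syll_t_def syll_t_inv_def syll_valid_Cons)

lemma syll_t_Cons:
  "syll_t N (d # l) = (if d = 0 then 1 # d # l else if Suc d = N then l else Suc d # l)"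
  by (simp add: syll_t_def)

lemma syll_t_pow_less:
  "l = [] \<or> hd l = 0 \<Longrightarrow> Suc i < N \<Longrightarrow> (syll_t N ^^ Suc i) l = Suc i # l"
proof (induction i)
  case 0
  then show ?case
    by (cases l) (auto simp: syll_t_def)
next
  case (Suc i)
  then have "(syll_t N ^^ Suc i) l = Suc i # l"
    by simp
  with Suc.prems show ?case
    by (simp add: syll_t_Cons)
qed

text \<open>From a list without a syllable of \<open>t\<close> on top, the powers of
  \<open>t\<close> run through \<open>1\<close>, ..., \<open>N - 1\<close> and return. A list with
  such a syllable on top lies on one of these cycles.\<close>

lemma syll_t_pow:
  assumes "syll_valid N l" "2 \<le> N"
  shows "(syll_t N ^^ N) l = l"
proof -
  have *: "(syll_t N ^^ N) l = l" if "l = [] \<or> hd l = 0" for l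
  proof -
    obtain i where i: "N = Suc (Suc i)"
      using assms(2) by (metis add_2_eq_Suc le_Suc_ex)
    then have "(syll_t N ^^ Suc i) l = Suc i # l"
      by (intro syll_t_pow_less that) simp
    then show ?thesis
      by (simp add: i syll_t_Cons)
  qed
  show ?thesis
  proof (cases "l = [] \<or> hd l = 0")
    case False
    then obtain j l' where l: "l = Suc j # l'"
      by (cases l; cases "hd l") auto
    then have l': "l' = [] \<or> hd l' = 0" "Suc j < N"
      using assms(1) by (auto simp: syll_valid_Cons)
    then have "(syll_t N ^^ N) l = (syll_t N ^^ Suc j) ((syll_t N ^^ N) l')"
      using syll_t_pow_less[OF l', symmetric] by (simp only: l funpow_add[THEN fun_cong, unfolded o_def, symmetric] add.commute)
    with l' show ?thesis
      by (simp only: * syll_t_pow_less l)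
  qed (rule *)
qed

lemma syll_t_inv_pow:
  assumes "syll_valid N l" "2 \<le> N"
  shows "(syll_t_inv N ^^ N) l = l"
proof -
  have valid: "syll_valid N ((syll_t_inv N ^^ m) l)" for m
    by (induction m) (auto simp: assms syll_t_inv_valid)
  have "(syll_t N ^^ m) ((syll_t_inv N ^^ m) l) = l" for m
  proof (induction m)
    case (Suc m)
    then show ?case
      by (simp add: funpow_swap1[of "syll_t N"] syll_t_t_inv valid assms(2))
  qed simp
  with syll_t_pow[OF valid assms(2)] show ?thesis
    by metis
qed

definition h_t :: "nat \<Rightarrow> bool \<Rightarrow> hstate \<Rightarrow> hstate" where
  "h_t N b h = (if b then (fst h + 1, syll_t N (snd h)) else (fst h - 1, syll_t_inv N (snd h)))"

text \<open>In the free product \<open>w\<close> has order two, so \<open>w\<close> and its inverse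
  act alike on the syllables; the integer component tells them apart.\<close>

definition h_w :: "int \<Rightarrow> bool \<Rightarrow> hstate \<Rightarrow> hstate" where
  "h_w s b h = (if b then fst h + s else fst h - s, syll_w (snd h))"

definition h_one :: hstate where
  "h_one = (0, [])"

abbreviation h_valid :: "nat \<Rightarrow> hstate \<Rightarrow> bool" where
  "h_valid N h \<equiv> syll_valid N (snd h)"

lemma h_t_valid: "h_valid N h \<Longrightarrow> 2 \<le> N \<Longrightarrow> h_valid N (h_t N b h)"
  by (simp add: h_t_def syll_t_valid syll_t_inv_valid)

lemma h_w_valid: "h_valid N h \<Longrightarrow> 2 \<le> N \<Longrightarrow> h_valid N (h_w s b h)"
  by (simp add: h_w_def syll_w_valid)

lemma h_t_cancel: "h_valid N h \<Longrightarrow> 2 \<le> N \<Longrightarrow> h_t N (\<not> b) (h_t N b h) = h"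
  by (simp add: h_t_def syll_t_t_inv syll_t_inv_t)

lemma h_w_cancel: "h_valid N h \<Longrightarrow> h_w s (\<not> b) (h_w s b h) = h"
  by (simp add: h_w_def syll_w_w)

lemma h_t_pow:
  assumes "h_valid N h" "2 \<le> N"
  shows "(h_t N b ^^ N) h = (if b then fst h + int N else fst h - int N, snd h)"
proof -
  have "(h_t N b ^^ m) h = (if b then (fst h + int m, (syll_t N ^^ m) (snd h))
      else (fst h - int m, (syll_t_inv N ^^ m) (snd h)))" for m
    by (induction m) (auto simp: h_t_def)
  with assms show ?thesis
    by (simp add: syll_t_pow syll_t_inv_pow)
qed

text \<open>
  An element of the free product of that group with a free group: its last factor in the group,
  followed by the preceding free generators, each with the factor in the group before it.
\<close>

type_synonym gstate = "hstate \<times> ((nat \<times> bool) \<times> hstate) list"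

definition flip :: "nat \<times> bool \<Rightarrow> nat \<times> bool" where
  "flip f = (fst f, \<not> snd f)"

lemma flip_flip [simp]: "flip (flip f) = f"
  by (simp add: flip_def)

lemma flip_Pair [simp]: "flip (i, b) = (i, \<not> b)"
  by (simp add: flip_def)

definition push :: "nat \<times> bool \<Rightarrow> gstate \<Rightarrow> gstate" where
  "push f g = (case snd g of [] \<Rightarrow> (h_one, [(f, fst g)]) | x # st \<Rightarrow>
     if fst g = h_one \<and> fst x = flip f then (snd x, st) else (h_one, (f, fst g) # x # st))"

definition on_top :: "(hstate \<Rightarrow> hstate) \<Rightarrow> gstate \<Rightarrow> gstate" where
  "on_top F g = (F (fst g), snd g)"

fun g_valid :: "nat \<Rightarrow> gstate \<Rightarrow> bool" where
  "g_valid N (h, []) \<longleftrightarrow> h_valid N h"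
| "g_valid N (h, (f, h') # st) \<longleftrightarrow> h_valid N h \<and> g_valid N (h', st) \<and>
     (case st of [] \<Rightarrow> True | x # st' \<Rightarrow> h' = h_one \<longrightarrow> fst x \<noteq> flip f)"

lemma g_valid_iff_on_top: "g_valid N (h, st) \<Longrightarrow> g_valid N (h', st) \<longleftrightarrow> h_valid N h'"
  by (cases st) auto

lemma g_valid_top: "g_valid N g \<Longrightarrow> h_valid N (fst g)"
  by (induction N g rule: g_valid.induct) auto

lemma on_top_valid: "g_valid N g \<Longrightarrow> (h_valid N (fst g) \<Longrightarrow> h_valid N (F (fst g))) \<Longrightarrow> g_valid N (on_top F g)"
  using g_valid_iff_on_top[of N "fst g" "snd g" "F (fst g)"] g_valid_top[of N g] by (simp add: on_top_def)

lemma push_valid: "g_valid N g \<Longrightarrow> g_valid N (push f g)"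
  by (cases "(N, g)" rule: g_valid.cases) (auto simp: push_def h_one_def split: list.splits)

lemma push_flip: "g_valid N g \<Longrightarrow> push (flip f) (push f g) = g"
  by (cases "(N, g)" rule: g_valid.cases) (auto simp: push_def split: list.splits)

section \<open>The action of the group on normal forms\<close>

lemma letter_pow_0 [simp]: "letter_pow y 0 = []"
  by (simp add: letter_pow_def)

lemma letter_pow_1 [simp]: "letter_pow y 1 = [(y, True)]"
  by (simp add: letter_pow_def)

lemma inv_word_letter_pow: "inv_word (letter_pow y m) = letter_pow y (- m)"
  by (cases "m = 0") (auto simp: letter_pow_def inv_word_def inv_letter_def map_replicate_const)

lemma words_letter_pow: "y \<in> Y \<Longrightarrow> letter_pow y m \<in> words Y"
  by (auto simp: letter_pow_def words_def)

locale relator =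
  fixes X :: "'a set" and t :: 'a and k :: nat and x :: "nat \<Rightarrow> 'a" and \<epsilon> n :: "nat \<Rightarrow> int"
    and s :: int and c :: "'a \<Rightarrow> nat"
  assumes t_notin: "t \<notin> X"
    and x_in: "i \<le> k \<Longrightarrow> x i \<in> X"
    and x_distinct: "i \<le> k \<Longrightarrow> j \<le> k \<Longrightarrow> x i = x j \<Longrightarrow> i = j"
    and s_nonzero: "s \<noteq> 0"
    and inj_c: "inj_on c (insert t X)"
begin

abbreviation "Y \<equiv> insert t X"

definition lett :: "nat \<Rightarrow> 'a \<times> bool" where
  "lett i = (x i, 0 \<le> \<epsilon> i)"

primrec p :: "nat \<Rightarrow> 'a word" where
  "p 0 = [lett 0]"
| "p (Suc j) = p j @ letter_pow t (n (Suc j)) @ [lett (Suc j)]"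

abbreviation "w \<equiv> p k"

definition r :: "'a word" where
  "r = w @ letter_pow t (- 2 * s) @ w"

definition N :: nat where
  "N = 2 * nat \<bar>s\<bar>"

lemma N_ge: "2 \<le> N"
  using s_nonzero by (simp add: N_def)

lemma lett_in_X: "i \<le> k \<Longrightarrow> fst (lett i) \<in> X"
  by (simp add: lett_def x_in)

lemma p_words: "j \<le> k \<Longrightarrow> p j \<in> words Y"
  by (induction j) (auto simp: words_letter_pow lett_in_X)

lemma r_words: "r \<in> words Y"
  by (simp add: r_def p_words words_letter_pow)

definition act_t :: "bool \<Rightarrow> gstate \<Rightarrow> gstate" where
  "act_t b = on_top (h_t N b)"

definition act_w :: "bool \<Rightarrow> gstate \<Rightarrow> gstate" where
  "act_w b = on_top (h_w s b)"

definition act_t_pow :: "int \<Rightarrow> gstate \<Rightarrow> gstate" where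
  "act_t_pow m = act_t (0 \<le> m) ^^ nat \<bar>m\<bar>"

text \<open>The prefixes below \<open>k\<close> are free generators, whereas \<open>p k\<close> is
  \<open>w\<close> and belongs to the factor with the relation.\<close>

definition act_p :: "nat \<Rightarrow> bool \<Rightarrow> gstate \<Rightarrow> gstate" where
  "act_p i b = (if i < k then push (i, b) else act_w b)"

text \<open>In the group, \<open>lett i\<close> equals \<open>t\<^sup>-\<^sup>n p\<^sub>i\<^sub>-\<^sub>1\<inverse> p\<^sub>i\<close> where \<open>n = n\<^sub>i\<close>.\<close>

definition act_x :: "nat \<Rightarrow> bool \<Rightarrow> gstate \<Rightarrow> gstate" where
  "act_x i b g = (case i of 0 \<Rightarrow> act_p 0 b g | Suc j \<Rightarrow>
     if b then act_p (Suc j) True (act_p j False (act_t_pow (- n (Suc j)) g))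
     else act_t_pow (n (Suc j)) (act_p j True (act_p (Suc j) False g)))"

definition x_index :: "'a \<Rightarrow> nat" where
  "x_index y = (THE i. i \<le> k \<and> x i = y)"

text \<open>Letters other than \<open>t\<close> that do not occur in \<open>w\<close> are free
  generators. The offset \<open>k\<close> keeps their indices apart from those of the
  prefixes.\<close>

definition act :: "'a \<times> bool \<Rightarrow> gstate \<Rightarrow> gstate" where
  "act a = (if fst a = t then act_t (snd a)
     else if fst a \<in> x ` {..k} then act_x (x_index (fst a)) (a = lett (x_index (fst a)))
     else push (k + c (fst a), snd a))"

definition acts :: "'a word \<Rightarrow> gstate \<Rightarrow> gstate" where
  "acts u g = foldl (\<lambda>g a. act a g) g u"

abbreviation valid :: "gstate \<Rightarrow> bool" where
  "valid \<equiv> g_valid N"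

lemma x_index: "i \<le> k \<Longrightarrow> x_index (x i) = i"
  unfolding x_index_def by (rule the_equality) (auto dest: x_distinct)

lemma acts_Nil [simp]: "acts [] g = g"
  by (simp add: acts_def)

lemma acts_Cons [simp]: "acts (a # u) g = acts u (act a g)"
  by (simp add: acts_def)

lemma acts_append [simp]: "acts (u @ v) g = acts v (acts u g)"
  by (simp add: acts_def)

lemma act_t_valid: "valid g \<Longrightarrow> valid (act_t b g)"
  by (simp add: act_t_def on_top_valid h_t_valid N_ge)

lemma act_w_valid: "valid g \<Longrightarrow> valid (act_w b g)"
  by (simp add: act_w_def on_top_valid h_w_valid N_ge)

lemma act_t_pow_valid: "valid g \<Longrightarrow> valid (act_t_pow m g)"
proof -
  assume "valid g"
  then have "valid ((act_t b ^^ i) g)" for b i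
    by (induction i) (auto simp: act_t_valid)
  then show ?thesis
    by (simp add: act_t_pow_def)
qed

lemma act_p_valid: "valid g \<Longrightarrow> valid (act_p i b g)"
  by (simp add: act_p_def push_valid act_w_valid)

lemma act_x_valid: "valid g \<Longrightarrow> valid (act_x i b g)"
  by (simp add: act_x_def act_p_valid act_t_pow_valid split: nat.split)

lemma act_valid: "valid g \<Longrightarrow> valid (act a g)"
  by (simp add: act_def act_t_valid act_x_valid push_valid)

lemma acts_valid: "valid g \<Longrightarrow> valid (acts u g)"
  by (induction u arbitrary: g) (simp_all add: act_valid)

lemma act_t_cancel: "valid g \<Longrightarrow> act_t (\<not> b) (act_t b g) = g"
  using h_t_cancel[of N "fst g" b] g_valid_top[of N g] N_ge by (simp add: act_t_def on_top_def)

lemma act_w_cancel: "valid g \<Longrightarrow> act_w (\<not> b) (act_w b g) = g"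
  using h_w_cancel[of N "fst g" s b] g_valid_top[of N g] by (simp add: act_w_def on_top_def)

lemma act_p_cancel: "valid g \<Longrightarrow> act_p i (\<not> b) (act_p i b g) = g"
  using push_flip[of N g "(i, b)"] by (simp add: act_p_def act_w_cancel)

lemma act_t_pow_cancel:
  assumes "valid g"
  shows "act_t_pow (- m) (act_t_pow m g) = g"
proof -
  have valid: "valid ((act_t b ^^ i) g)" for b i
    using assms by (induction i) (auto simp: act_t_valid)
  have "(act_t (\<not> b) ^^ i) ((act_t b ^^ i) g) = g" for b i
  proof (induction i)
    case (Suc i)
    then show ?case
      by (simp add: funpow_swap1[of "act_t (\<not> b)"] act_t_cancel valid)
  qed simp
  from this[of "nat \<bar>m\<bar>" "0 \<le> m"] show ?thesis
    by (cases m "0 :: int" rule: linorder_cases) (auto simp: act_t_pow_def)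
qed

lemma act_x_cancel: "valid g \<Longrightarrow> act_x i (\<not> b) (act_x i b g) = g"
  using act_p_cancel[of _ _ True] act_p_cancel[of _ _ False] act_t_pow_cancel act_t_pow_cancel[of _ "- _"]
  by (cases b) (auto simp: act_x_def act_p_cancel act_p_valid act_t_pow_valid split: nat.split)

lemma act_cancel:
  assumes "valid g"
  shows "act (inv_letter a) (act a g) = g"
proof (cases "fst a = t")
  case True
  then show ?thesis
    using assms by (simp add: act_def inv_letter_def act_t_cancel)
next
  case False
  then show ?thesis
  proof (cases "fst a \<in> x ` {..k}")
    case True
    then obtain i where i: "i \<le> k" "fst a = x i"
      by auto
    then have "inv_letter a = lett i \<longleftrightarrow> a \<noteq> lett i"
      by (auto simp: lett_def inv_letter_def prod_eq_iff)
    with i False True assms show ?thesis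
      by (simp add: act_def x_index) (simp add: inv_letter_def x_index act_x_cancel)
  next
    case notx: False
    with False show ?thesis
      using push_flip[OF assms, of "(k + c (fst a), snd a)"] by (simp add: act_def inv_letter_def)
  qed
qed

lemma act_lett: "i \<le> k \<Longrightarrow> act (lett i) = act_x i True"
  using x_in t_notin by (auto simp: act_def lett_def x_index)

lemma act_inv_lett: "i \<le> k \<Longrightarrow> act (inv_letter (lett i)) = act_x i False"
  using x_in t_notin by (auto simp: act_def lett_def x_index inv_letter_def)

lemma acts_letter_pow: "acts (letter_pow t m) g = act_t_pow m g"
proof -
  have "acts (replicate i (t, b)) g = (act_t b ^^ i) g" for i b
    by (induction i arbitrary: g) (auto simp: act_def funpow_swap1)
  then show ?thesis
    by (simp add: letter_pow_def act_t_pow_def)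
qed

text \<open>The product telescopes: \<open>lett (Suc j)\<close> acts as the inverse power of
  \<open>t\<close>, then the inverse of \<open>p j\<close>, then \<open>p (Suc j)\<close>, and the
  first two undo what has been read so far.\<close>

lemma acts_p: "j \<le> k \<Longrightarrow> valid g \<Longrightarrow> acts (p j) g = act_p j True g"
proof (induction j)
  case 0
  then show ?case
    by (simp add: act_lett act_x_def)
next
  case (Suc j)
  then show ?case
    using act_p_cancel[of g j True]
    by (simp add: acts_letter_pow act_lett act_x_def act_t_pow_cancel act_p_valid)
qed

lemma act_t_pow_period: "valid g \<Longrightarrow> act_t_pow (- 2 * s) g = ((fst (fst g) - 2 * s, snd (fst g)), snd g)"
proof -
  assume "valid g"
  then have h: "h_valid N (fst g)"
    by (rule g_valid_top)
  have "(act_t b ^^ i) g = on_top (h_t N b ^^ i) g" for b i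
    by (induction i) (auto simp: act_t_def on_top_def)
  moreover have "nat \<bar>- 2 * s\<bar> = N" "int N = 2 * \<bar>s\<bar>"
    by (auto simp: N_def)
  ultimately show ?thesis
    using s_nonzero h_t_pow[OF h N_ge, of "0 \<le> - 2 * s"] by (auto simp: act_t_pow_def on_top_def)
qed

text \<open>The middle power of \<open>t\<close> only shifts the integer component, by
  \<open>- 2 * s\<close>. Each \<open>w\<close> shifts it by \<open>s\<close>, and the two of them
  cancel on the syllables.\<close>

lemma acts_r:
  assumes "valid g"
  shows "acts r g = g"
proof -
  have "valid (act_w True g)"
    using assms by (rule act_w_valid)
  note period = act_t_pow_period[OF this]
  have "acts r g = act_w True (act_t_pow (- 2 * s) (act_w True g))"
    using assms by (simp add: r_def acts_p acts_letter_pow act_p_def act_w_valid act_t_pow_valid del: mult_minus_left)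
  also have "\<dots> = g"
    unfolding period using g_valid_top[OF assms]
    by (simp add: act_w_def on_top_def h_w_def syll_w_w)
  finally show ?thesis .
qed

text \<open>The group acts on valid states, so \<open>acts u g_one\<close> is an invariant of the
  element represented by \<open>u\<close>. That it is a complete invariant follows later from
  \<open>g_word\<close>.\<close>

lemma acts_cong: "(u, v) \<in> cong_gen Y (gp_rels Y r) \<Longrightarrow> valid g \<Longrightarrow> acts u g = acts v g"
proof (induction arbitrary: g rule: cong_gen.induct)
  case (base u v)
  then show ?case
    by (auto simp: gp_rels_def acts_r act_cancel)
next
  case (mult u v u' v')
  then show ?case
    by (simp add: acts_valid)
qed auto

section \<open>Words for normal forms\<close>

text \<open>The segment of \<open>w\<close> between the ends of two prefixes, traversed backwards if
  \<open>j < i\<close>. It is what remains of the inverse of \<open>p i\<close> times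
  \<open>p j\<close> once the common prefix is cancelled.\<close>

definition chord :: "nat \<Rightarrow> nat \<Rightarrow> 'a word" where
  "chord i j = (if i \<le> j then drop (length (p i)) (p j) else inv_word (drop (length (p j)) (p i)))"

lemma p_chord: "i \<le> j \<Longrightarrow> p i @ chord i j = p j"
proof -
  assume "i \<le> j"
  then have "prefix (p i) (p j)"
    by (induction j rule: dec_induct) (auto intro: prefix_order.trans)
  then show ?thesis
    using \<open>i \<le> j\<close> by (auto simp: chord_def elim: prefixE)
qed

lemma chord_trans: "i \<le> j \<Longrightarrow> j \<le> l \<Longrightarrow> chord i j @ chord j l = chord i l"
proof -
  assume "i \<le> j" "j \<le> l"
  then have "(p i @ chord i j) @ chord j l = p i @ chord i l"
    by (simp only: p_chord le_trans)
  then show ?thesis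
    by simp
qed

lemma chord_same [simp]: "chord i i = []"
  by (simp add: chord_def)

lemma inv_word_chord: "inv_word (chord i j) = chord j i"
  by (cases i j rule: linorder_cases) (auto simp: chord_def)

lemma chord_Suc: "chord j (Suc j) = letter_pow t (n (Suc j)) @ [lett (Suc j)]"
  by (simp add: chord_def)

fun syll_word :: "nat list \<Rightarrow> 'a word" where
  "syll_word [] = []"
| "syll_word (d # l) = syll_word l @ (if d = 0 then w else letter_pow t (int d))"

fun syll_sum :: "nat list \<Rightarrow> int" where
  "syll_sum [] = 0"
| "syll_sum (d # l) = syll_sum l + (if d = 0 then s else int d)"

text \<open>Syllables determine an element only up to powers of w^2 = t^(2s). The leading power of
  \<open>t\<close> adjusts the total exponent to the integer component.\<close>

definition h_word :: "hstate \<Rightarrow> 'a word" where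
  "h_word h = letter_pow t (fst h - syll_sum (snd h)) @ syll_word (snd h)"

definition f_word :: "nat \<times> bool \<Rightarrow> 'a word" where
  "f_word f = (let u = if fst f < k then p (fst f) else [(inv_into Y c (fst f - k), True)]
     in if snd f then u else inv_word u)"

text \<open>
  The factor \<open>p\<^sub>i\<inverse> p\<^sub>j\<close> is written as \<open>chord i j\<close>, which represents the same element of the group but
  is above it in the inverse monoid. This makes the words for normal forms maximal in the natural
  partial order.
\<close>

fun st_word :: "((nat \<times> bool) \<times> hstate) list \<Rightarrow> 'a word" where
  "st_word [] = []"
| "st_word [(f, h)] = h_word h @ f_word f"
| "st_word ((f, h) # (f', h') # st) =
     (if h = h_one \<and> snd f \<and> \<not> snd f' \<and> fst f < k \<and> fst f' < k
      then st_word st @ h_word h' @ chord (fst f') (fst f)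
      else st_word ((f', h') # st) @ h_word h @ f_word f)"

definition g_word :: "gstate \<Rightarrow> 'a word" where
  "g_word g = st_word (snd g) @ h_word (fst g)"

definition g_one :: gstate where
  "g_one = (h_one, [])"

lemma g_one_valid: "valid g_one"
  by (simp add: g_one_def h_one_def)

lemma h_word_one [simp]: "h_word h_one = []"
  by (simp add: h_word_def h_one_def)

lemma g_word_one: "g_word g_one = []"
  by (simp add: g_word_def g_one_def)

end

section \<open>Normal forms evaluated in an inverse monoid in which the relator is trivial\<close>

locale relator_hom = relator X t k x \<epsilon> n s c + inverse_monoid_hom \<phi>
  for X :: "'a set" and t k x \<epsilon> n s c and \<phi> :: "'a word \<Rightarrow> 'm::monoid_mult" +
  assumes hom_r: "\<phi> r = 1"
begin

abbreviation "tp m \<equiv> \<phi> (letter_pow t m)"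

lemma w_tp_w: "\<phi> w * (tp (- 2 * s) * \<phi> w) = 1"
  using hom_r by (simp only: r_def hom_append)

text \<open>As a prefix of the relator \<open>w\<close> is a right unit, as a suffix it is a left
  unit.\<close>

lemma w_inverse: "\<phi> w * \<phi> (inv_word w) = 1" "\<phi> (inv_word w) * \<phi> w = 1"
  using right_unit[OF w_tp_w] left_unit[of "\<phi> w * tp (- 2 * s)" w] w_tp_w by (simp_all add: mult.assoc)

lemma tp_period_eq: "tp (- 2 * s) = \<phi> (inv_word w) * \<phi> (inv_word w)"
proof -
  have "tp (- 2 * s) = (\<phi> (inv_word w) * \<phi> w) * tp (- 2 * s) * (\<phi> w * \<phi> (inv_word w))"
    by (simp only: w_inverse mult_1_left mult_1_right)
  also have "\<dots> = \<phi> (inv_word w) * (\<phi> w * (tp (- 2 * s) * \<phi> w)) * \<phi> (inv_word w)"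
    by (simp only: mult.assoc)
  finally show ?thesis
    by (simp only: w_tp_w mult_1_right)
qed

lemma tp_period_unit: "tp (- 2 * s) * (\<phi> w * \<phi> w) = 1" "(\<phi> w * \<phi> w) * tp (- 2 * s) = 1"
proof -
  have *: "a * b = 1 \<Longrightarrow> a * (b * y) = y" for a b y :: 'm
    by (simp flip: mult.assoc)
  show "tp (- 2 * s) * (\<phi> w * \<phi> w) = 1" "(\<phi> w * \<phi> w) * tp (- 2 * s) = 1"
    unfolding tp_period_eq by (simp_all add: mult.assoc *[OF w_inverse(1)] *[OF w_inverse(2)] w_inverse)
qed

text \<open>The power of \<open>t\<close> in the relator is a unit, and it is not the empty word
  since \<open>s\<close> is nonzero. Its first letter is a right unit, its last letter a left unit,
  and these are the same letter.\<close>

lemma t_inverse: "\<phi> [(t, b)] * \<phi> [(t, \<not> b)] = 1"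
proof -
  obtain m where m: "nat \<bar>- 2 * s\<bar> = Suc m"
    using s_nonzero by (cases "nat \<bar>- 2 * s\<bar>") auto
  define b' where "b' = (0 \<le> - 2 * s)"
  have "letter_pow t (- 2 * s) = replicate (Suc m) (t, b')"
    by (simp only: letter_pow_def m b'_def)
  then have Cons: "letter_pow t (- 2 * s) = [(t, b')] @ replicate m (t, b')"
    and snoc: "letter_pow t (- 2 * s) = replicate m (t, b') @ [(t, b')]"
    by (simp_all add: replicate_append_same)
  have "\<phi> [(t, b')] * \<phi> (inv_word [(t, b')]) = 1"
    using tp_period_unit(1) unfolding Cons hom_append by (intro right_unit) (simp add: mult.assoc)
  moreover have "\<phi> (inv_word [(t, b')]) * \<phi> [(t, b')] = 1"
    using tp_period_unit(2) unfolding snoc hom_append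
    by (intro left_unit[of "\<phi> w * \<phi> w * \<phi> (replicate m (t, b'))"]) (simp add: mult.assoc)
  ultimately show ?thesis
    by (cases b; cases b') (simp_all add: inv_word_def inv_letter_def)
qed

lemma tp_Suc: "tp (m + 1) = tp m * \<phi> [(t, True)]"
proof (cases "0 \<le> m")
  case True
  then have "letter_pow t (m + 1) = letter_pow t m @ [(t, True)]"
    by (simp add: letter_pow_def nat_add_distrib replicate_append_same)
  then show ?thesis
    by (simp add: hom_append)
next
  case False
  then have "nat \<bar>m\<bar> = Suc (nat \<bar>m + 1\<bar>)"
    by simp
  with False have "letter_pow t m = letter_pow t (m + 1) @ [(t, False)]"
    by (cases "m = - 1") (auto simp: letter_pow_def replicate_append_same)
  then show ?thesis
    using t_inverse[of False] by (simp add: hom_append mult.assoc)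
qed

lemma tp_pred: "tp (m - 1) = tp m * \<phi> [(t, False)]"
  using tp_Suc[of "m - 1"] t_inverse[of True] by (simp add: mult.assoc)

lemma tp_add: "tp (a + b) = tp a * tp b"
proof (induction b rule: int_induct[where k = 0])
  case (step1 b)
  then show ?case
    using tp_Suc[of "a + b"] tp_Suc[of b] by (simp add: mult.assoc add.assoc)
next
  case (step2 b)
  then show ?case
    using tp_pred[of "a + b"] tp_pred[of b] by (simp add: mult.assoc algebra_simps)
qed (simp add: hom_Nil)

lemma tp_add_left: "tp a * (tp b * y) = tp (a + b) * y"
  by (simp add: tp_add mult.assoc)

lemma w_square: "\<phi> w * \<phi> w = tp (2 * s)"
proof -
  have "\<phi> w * \<phi> w = \<phi> w * \<phi> w * (tp (- 2 * s) * tp (2 * s))"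
    by (simp add: hom_Nil flip: tp_add)
  also have "\<dots> = tp (2 * s)"
    using tp_period_unit(2) by (metis mult.assoc mult_1_left)
  finally show ?thesis .
qed

lemma w_commute: "tp (2 * s) * \<phi> w = \<phi> w * tp (2 * s)"
  by (simp add: mult.assoc flip: w_square)

lemma w_commute': "tp (- 2 * s) * \<phi> w = \<phi> w * tp (- 2 * s)"
proof -
  have "tp (- 2 * s) * \<phi> w = tp (- 2 * s) * \<phi> w * (tp (2 * s) * tp (- 2 * s))"
    by (simp add: hom_Nil flip: tp_add)
  also have "\<dots> = tp (- 2 * s) * (\<phi> w * tp (2 * s)) * tp (- 2 * s)"
    by (simp only: mult.assoc)
  also have "\<dots> = (tp (- 2 * s) * tp (2 * s)) * \<phi> w * tp (- 2 * s)"
    by (simp only: mult.assoc flip: w_commute)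
  finally show ?thesis
    by (simp add: hom_Nil flip: tp_add)
qed

text \<open>This power of \<open>t\<close> is the square of \<open>w\<close> or its inverse, so it
  commutes with \<open>w\<close> as well as with \<open>t\<close>.\<close>

lemma syll_word_commute:
  assumes "m = 2 * s \<or> m = - 2 * s"
  shows "\<phi> (syll_word l) * tp m = tp m * \<phi> (syll_word l)"
proof (induction l)
  case (Cons d l)
  have "\<phi> w * tp m = tp m * \<phi> w"
    using assms w_commute w_commute' by metis
  moreover have "tp (int d) * tp m = tp m * tp (int d)"
    by (simp add: add.commute flip: tp_add)
  ultimately have d: "\<phi> (if d = 0 then w else letter_pow t (int d)) * tp m =
      tp m * \<phi> (if d = 0 then w else letter_pow t (int d))"
    by simp
  have "\<phi> (syll_word (d # l)) * tp m =
      \<phi> (syll_word l) * (\<phi> (if d = 0 then w else letter_pow t (int d)) * tp m)"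
    by (simp only: syll_word.simps hom_append mult.assoc)
  also have "\<dots> = (\<phi> (syll_word l) * tp m) * \<phi> (if d = 0 then w else letter_pow t (int d))"
    by (simp only: d mult.assoc)
  finally show ?case
    by (simp only: Cons syll_word.simps hom_append mult.assoc)
qed (simp add: hom_Nil)

lemma h_word_t_True:
  "\<phi> (h_word (h_t N True h)) = \<phi> (h_word h) * \<phi> [(t, True)]"
proof (cases "snd h")
  case Nil
  then show ?thesis
    by (simp add: h_word_def h_t_def syll_t_def hom_append hom_Nil)
next
  case (Cons d l)
  consider "d = 0" | "d \<noteq> 0" "Suc d = N" | "d \<noteq> 0" "Suc d \<noteq> N"
    by blast
  then show ?thesis
  proof cases
    case 2
    \<comment> \<open>The top syllable is completed to the \<open>N\<close>-th power of
      \<open>t\<close>, which commutes with the remaining syllables and is absorbed by the leading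
      power.\<close>
    then have N: "1 + int d = 2 * s \<or> 1 + int d = - 2 * s"
      by (auto simp: N_def)
    have "\<phi> (h_word h) * \<phi> [(t, True)] = tp (fst h - syll_sum l - int d) * (\<phi> (syll_word l) * tp (1 + int d))"
      using Cons 2 tp_Suc[of "int d"] by (simp add: h_word_def hom_append mult.assoc algebra_simps)
    also have "\<dots> = tp (fst h + 1 - syll_sum l) * \<phi> (syll_word l)"
      by (simp add: syll_word_commute[OF N] tp_add_left algebra_simps)
    finally show ?thesis
      using Cons 2 by (simp add: h_word_def h_t_def syll_t_def hom_append)
  next
    case 3
    then show ?thesis
      using Cons tp_Suc[of "int d"]
      by (simp add: h_word_def h_t_def syll_t_def hom_append mult.assoc algebra_simps)
  qed (simp add: Cons h_word_def h_t_def syll_t_def hom_append mult.assoc)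
qed

lemma h_word_t:
  assumes "h_valid N h"
  shows "\<phi> (h_word (h_t N b h)) = \<phi> (h_word h) * \<phi> [(t, b)]"
proof (cases b)
  case False
  have "\<phi> (h_word h) = \<phi> (h_word (h_t N False h)) * \<phi> [(t, True)]"
    using h_word_t_True[of "h_t N False h"] h_t_cancel[OF assms N_ge, of False] by simp
  with False show ?thesis
    using t_inverse[of True] by (simp add: mult.assoc)
qed (simp add: h_word_t_True)

abbreviation signed :: "'a word \<Rightarrow> bool \<Rightarrow> 'a word" where
  "signed u b \<equiv> if b then u else inv_word u"

lemma h_word_w_True: "\<phi> (h_word (h_w s True h)) = \<phi> (h_word h) * \<phi> w"
proof (cases "snd h")
  case Nil
  then show ?thesis
    by (simp add: h_word_def h_w_def syll_w_def hom_append hom_Nil)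
next
  case (Cons d l)
  show ?thesis
  proof (cases "d = 0")
    case True
    have "\<phi> (h_word h) * \<phi> w = tp (fst h - syll_sum l - s) * (\<phi> (syll_word l) * (\<phi> w * \<phi> w))"
      using Cons True by (simp add: h_word_def hom_append mult.assoc algebra_simps)
    also have "\<dots> = tp (fst h + s - syll_sum l) * \<phi> (syll_word l)"
      by (simp add: w_square syll_word_commute tp_add_left algebra_simps)
    finally show ?thesis
      using Cons True by (simp add: h_word_def h_w_def syll_w_def hom_append)
  qed (simp add: Cons h_word_def h_w_def syll_w_def hom_append mult.assoc)
qed

lemma h_word_w:
  assumes "h_valid N h"
  shows "\<phi> (h_word (h_w s b h)) = \<phi> (h_word h) * \<phi> (signed w b)"
proof (cases b)
  case False
  have "\<phi> (h_word h) = \<phi> (h_word (h_w s False h)) * \<phi> w"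
    using h_word_w_True[of "h_w s False h"] h_w_cancel[OF assms, of s False] by simp
  with False show ?thesis
    using w_inverse by (simp add: mult.assoc)
qed (simp add: h_word_w_True)

lemma g_word_t: "valid g \<Longrightarrow> \<phi> (g_word (act_t b g)) = \<phi> (g_word g) * \<phi> [(t, b)]"
  by (simp add: g_word_def act_t_def on_top_def hom_append h_word_t g_valid_top mult.assoc)

lemma g_word_w: "valid g \<Longrightarrow> \<phi> (g_word (act_w b g)) = \<phi> (g_word g) * \<phi> (signed w b)"
  by (simp only: g_word_def act_w_def on_top_def hom_append h_word_w g_valid_top mult.assoc fst_conv snd_conv)

lemma g_word_t_pow:
  assumes "valid g"
  shows "\<phi> (g_word (act_t_pow m g)) = \<phi> (g_word g) * tp m"
proof -
  have "valid ((act_t b ^^ i) g) \<and> \<phi> (g_word ((act_t b ^^ i) g)) = \<phi> (g_word g) * \<phi> (replicate i (t, b))" for b i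
  proof (induction i)
    case (Suc i)
    have "replicate (Suc i) (t, b) = replicate i (t, b) @ [(t, b)]"
      by (simp add: replicate_append_same)
    then show ?case
      using Suc by (simp add: act_t_valid g_word_t mult.assoc hom_append del: replicate_Suc)
  qed (simp add: assms hom_Nil)
  then show ?thesis
    by (simp add: act_t_pow_def letter_pow_def)
qed

lemma p_chord_le: "p i @ chord i j \<preceq> p j"
proof (cases "i \<le> j")
  case False
  then have "p i @ chord i j = p j @ (chord j i @ inv_word (chord j i))"
    using p_chord[of j i] by (simp add: inv_word_chord flip: append.assoc)
  then show ?thesis
    using le_append_left[OF le_Nil(1)[of "chord j i"], of "p j"] by simp
qed (simp add: p_chord)

text \<open>Both factors move along the same line \<open>w\<close>. Either the middle point lies on
  the way, or the product contains a segment followed by its inverse, an idempotent below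
  \<open>1\<close>.\<close>

lemma chord_le_trans: "chord i j @ chord j l \<preceq> chord i l"
proof -
  have detour: "u @ (chord a b @ chord b a) @ v \<preceq> u @ v" for u v a b
    using le_append_left[OF le_append_right[OF le_Nil(1)[of "chord a b"], of v], of u]
    by (simp add: inv_word_chord)
  have rev_trans: "chord a b @ chord b d = chord a d" if "b \<le> a" "d \<le> b" for a b d
    using arg_cong[OF chord_trans[OF that(2,1)], of inv_word] by (simp add: inv_word_chord)
  consider "i \<le> j" "j \<le> l" | "i \<le> l" "l \<le> j" | "l \<le> i" "i \<le> j" | "j \<le> i" "i \<le> l" | "j \<le> l" "l \<le> i" | "l \<le> j" "j \<le> i"
    by linarith
  then show ?thesis
  proof cases
    case 1
    then show ?thesis by (simp add: chord_trans)
  next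
    case 2
    then show ?thesis using detour[of "chord i l" l j "[]"] by (simp flip: chord_trans[of i l j])
  next
    case 3
    then show ?thesis using detour[of "[]" i j "chord i l"] by (simp flip: rev_trans[of i j l])
  next
    case 4
    then show ?thesis using detour[of "[]" i j "chord i l"] by (simp flip: chord_trans[of j i l])
  next
    case 5
    then show ?thesis using detour[of "chord i l" l j "[]"] by (simp flip: rev_trans[of l i j])
  next
    case 6
    then show ?thesis by (simp add: rev_trans)
  qed
qed

end

context relator
begin

lemma f_word_p: "i < k \<Longrightarrow> f_word (i, b) = (if b then p i else inv_word (p i))"
  by (simp add: f_word_def)

lemma f_word_flip: "f_word (flip f) = inv_word (f_word f)"
  by (simp add: f_word_def flip_def Let_def)

lemma f_word_letter: "y \<in> Y \<Longrightarrow> f_word (k + c y, b) = [(y, b)]"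
  using inj_c by (simp add: f_word_def inv_word_def inv_letter_def Let_def)

lemma st_word_simple:
  "\<not> snd f \<or> \<not> fst f < k \<Longrightarrow> st_word ((f, h) # st) = st_word st @ h_word h @ f_word f"
  by (cases st) (auto split: prod.splits)

lemma st_word_cases:
  obtains (chord) f' h' st' where "st = (f', h') # st'" "h = h_one" "snd f" "\<not> snd f'"
      "fst f < k" "fst f' < k" "st_word ((f, h) # st) = st_word st' @ h_word h' @ chord (fst f') (fst f)"
  | (simple) "st_word ((f, h) # st) = st_word st @ h_word h @ f_word f"
      "\<And>f' h' st'. st = (f', h') # st' \<Longrightarrow> \<not> (h = h_one \<and> snd f \<and> \<not> snd f' \<and> fst f < k \<and> fst f' < k)"
proof (cases st)
  case Nil
  then show ?thesis
    using simple by simp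
next
  case (Cons x st')
  obtain f' h' where x: "x = (f', h')"
    by (cases x)
  show ?thesis
  proof (cases "h = h_one \<and> snd f \<and> \<not> snd f' \<and> fst f < k \<and> fst f' < k")
    case True
    then show ?thesis
      using chord Cons x by simp
  next
    case False
    then show ?thesis
      using simple Cons x by (simp only: st_word.simps if_False) simp
  qed
qed

lemma push_cases:
  obtains (pop) st h' where "g = (h_one, (flip f, h') # st)" "push f g = (h', st)"
  | (push) h st where "g = (h, st)" "push f g = (h_one, (f, h) # st)"
      "\<And>h' st'. st = (flip f, h') # st' \<Longrightarrow> h \<noteq> h_one"
proof (cases "fst g = h_one \<and> snd g \<noteq> [] \<and> fst (hd (snd g)) = flip f")
  case True
  then obtain h' st where "g = (h_one, (flip f, h') # st)"
    by (cases g; cases "snd g") auto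
  then show ?thesis
    using pop by (simp add: push_def)
next
  case False
  then have "push f g = (h_one, (f, fst g) # snd g)"
    by (auto simp: push_def split: list.split)
  moreover have "fst g \<noteq> h_one" if "snd g = (flip f, h') # st'" for h' st'
    using False that by simp
  ultimately show ?thesis
    using push[of "fst g" "snd g"] by simp
qed

end

context relator_hom
begin

lemma p_inv_p_le: "inv_word (p i) @ p j \<preceq> chord i j"
proof (cases "i \<le> j")
  case True
  then show ?thesis
    using le_append_right[OF le_Nil(2)[of "p i"], of "chord i j"] p_chord[of i j] by simp
next
  case False
  then have "inv_word (p i) = chord i j @ inv_word (p j)"
    using arg_cong[OF p_chord[of j i], of inv_word] by (simp add: inv_word_chord)
  then show ?thesis
    using le_append_left[OF le_Nil(2)[of "p j"], of "chord i j"] by simp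
qed

lemma chord_p_inv_le: "chord i j @ inv_word (p j) \<preceq> inv_word (p i)"
proof (cases "i \<le> j")
  case True
  then have "inv_word (p j) = chord j i @ inv_word (p i)"
    using arg_cong[OF p_chord[of i j], of inv_word] by (simp add: inv_word_chord)
  then show ?thesis
    using le_append_right[OF le_Nil(1)[of "chord i j"], of "inv_word (p i)"]
    by (simp add: inv_word_chord)
next
  case False
  then have "inv_word (p i) = chord i j @ inv_word (p j)"
    using arg_cong[OF p_chord[of j i], of inv_word] by (simp add: inv_word_chord)
  then show ?thesis
    by simp
qed

text \<open>\<open>chord i k\<close> followed by the inverse of \<open>w\<close> is a right inverse
  of \<open>p i\<close>, hence the inverse by uniqueness. Since \<open>w\<close> is a unit nothing
  is lost here, so only prefixes with index below \<open>k\<close> have to be merged into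
  chords.\<close>

lemma chord_k:
  assumes "i \<le> k"
  shows "\<phi> (chord i k) = \<phi> (inv_word (p i)) * \<phi> w"
proof -
  let ?v = "chord i k @ inv_word w"
  have "\<phi> (p i) * \<phi> ?v = \<phi> (p i @ chord i k) * \<phi> (inv_word w)"
    by (simp only: hom_append mult.assoc)
  then have 1: "\<phi> (p i) * \<phi> ?v = 1"
    by (simp only: p_chord[OF assms] w_inverse)
  have v: "\<phi> ?v = \<phi> (inv_word (p i))"
    by (rule inverse_unique) (simp_all only: 1 mult_1_right mult_1_left flip: mult.assoc)
  then have "\<phi> (inv_word (p i)) * \<phi> w = \<phi> (chord i k) * (\<phi> (inv_word w) * \<phi> w)"
    by (simp only: hom_append mult.assoc flip: v)
  then show ?thesis
    by (simp only: w_inverse mult_1_right)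
qed

lemma k_chord: "i \<le> k \<Longrightarrow> \<phi> (chord k i) = \<phi> (inv_word w) * \<phi> (p i)"
  using inv_word_cong[of "chord i k" "inv_word (p i) @ w"] chord_k[of i]
  by (simp add: hom_append inv_word_chord)

text \<open>The word can change in three ways: a generator cancels against its inverse, an inverse
  prefix and a prefix merge into a chord, or a chord is dissolved again. Each is one of the
  inequalities for prefixes and chords.\<close>

lemma g_word_push: "g_word g @ f_word f \<preceq> g_word (push f g)"
proof (cases rule: push_cases[of g f])
  case (pop st h')
  show ?thesis
  proof (cases rule: st_word_cases[where st = st and h = h' and f = "flip f"])
    case (chord f' h'' st')
    obtain i j where ij: "f = (i, False)" "f' = (j, False)" "i < k" "j < k"
      using chord by (cases f; cases f') (auto simp: flip_def)
    let ?A = "st_word st' @ h_word h''"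
    have "g_word g @ f_word f = ?A @ (chord j i @ inv_word (p i))"
      using pop chord ij by (simp add: g_word_def f_word_p)
    moreover have "g_word (push f g) = ?A @ inv_word (p j)"
      using pop chord ij by (simp add: g_word_def st_word_simple f_word_p)
    ultimately show ?thesis
      using le_append_left[OF chord_p_inv_le, of ?A j i] by simp
  next
    case simple
    then have "g_word g @ f_word f = g_word (push f g) @ (inv_word (f_word f) @ f_word f)"
      using pop by (simp add: g_word_def f_word_flip)
    then show ?thesis
      using le_append_left[OF le_Nil(2)[of "f_word f"], of "g_word (push f g)"] by simp
  qed
next
  case (push h st)
  show ?thesis
  proof (cases rule: st_word_cases[where st = st and h = h and f = f])
    case (chord f' h' st')
    obtain i j where ij: "f = (i, True)" "f' = (j, False)" "i < k" "j < k"
      using chord by (cases f; cases f') auto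
    let ?A = "st_word st' @ h_word h'"
    have "g_word g @ f_word f = ?A @ (inv_word (p j) @ p i)"
      using push chord ij by (simp add: g_word_def f_word_p st_word_simple)
    moreover have "g_word (push f g) = ?A @ chord j i"
      using push chord ij by (simp add: g_word_def)
    ultimately show ?thesis
      using le_append_left[OF p_inv_p_le, of ?A j i] by simp
  next
    case simple
    with push show ?thesis
      by (simp add: g_word_def)
  qed
qed

text \<open>Two uses of \<open>g_word_push\<close> would only bound the inverse of
  \<open>p i\<close> followed by \<open>p j\<close>, and that product lies below
  \<open>chord i j\<close>. So both pushes are treated together, and a chord already ending at
  \<open>i\<close> is extended or shortened to end at \<open>j\<close>.\<close>

lemma g_word_push_chord:
  assumes "i < k" "j < k" "i \<noteq> j"
  shows "g_word g @ chord i j \<preceq> g_word (push (j, True) (push (i, False) g))"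
proof (cases rule: push_cases[of g "(i, False)"])
  case (pop st h')
  show ?thesis
  proof (cases rule: st_word_cases[where st = st and h = h' and f = "(i, True)"])
    case (chord f' h'' st')
    obtain l where l: "f' = (l, False)" "l < k"
      using chord by (cases f') auto
    let ?A = "st_word st' @ h_word h''"
    have "g_word g @ chord i j = ?A @ (chord l i @ chord i j)"
      using pop chord l by (simp add: g_word_def)
    moreover have "g_word (push (j, True) (push (i, False) g)) = ?A @ chord l j"
      using pop chord l assms by (simp add: g_word_def push_def)
    ultimately show ?thesis
      using le_append_left[OF chord_le_trans, of ?A l i j] by simp
  next
    case simple
    have st: "push (j, True) (h', st) = (h_one, ((j, True), h') # st)"
    proof (cases rule: push_cases[of "(h', st)" "(j, True)"])
      case (pop st' h'')
      then show ?thesis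
        using simple(2)[of "(j, False)" h'' st'] assms by simp
    qed simp
    have "st_word (((j, True), h') # st) = st_word st @ h_word h' @ p j"
    proof (cases rule: st_word_cases[where st = st and h = h' and f = "(j, True)"])
      case (chord f' h'' st')
      then show ?thesis
        using simple(2)[of f' h'' st'] assms by simp
    qed (simp add: f_word_p assms)
    moreover have "g_word g @ chord i j = (st_word st @ h_word h') @ p i @ chord i j"
      using pop simple(1) by (simp add: g_word_def f_word_p assms)
    ultimately show ?thesis
      using pop st le_append_left[OF p_chord_le, of "st_word st @ h_word h'" i j] by (simp add: g_word_def)
  qed
next
  case (push h st)
  with assms show ?thesis
    by (simp add: g_word_def push_def)
qed

lemma g_word_p:
  assumes "valid g" "i \<le> k"
  shows "g_word g @ signed (p i) b \<preceq> g_word (act_p i b g)"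
proof (cases "i < k")
  case True
  then show ?thesis
    using g_word_push[of g "(i, b)"] by (simp add: act_p_def f_word_p)
next
  case False
  with assms show ?thesis
    by (intro le_if_eq) (simp add: act_p_def g_word_w hom_append)
qed

lemma g_word_chord:
  assumes "valid g" "i \<le> k" "j \<le> k" "i \<noteq> j"
  shows "g_word g @ chord i j \<preceq> g_word (act_p j True (act_p i False g))"
proof -
  consider "i < k" "j < k" | "j = k" "i < k" | "i = k" "j < k"
    using assms by linarith
  then show ?thesis
  proof cases
    case 1
    then show ?thesis
      using g_word_push_chord assms by (simp add: act_p_def)
  next
    case 2
    have "g_word g @ chord i j \<preceq> (g_word g @ inv_word (p i)) @ w"
      by (rule le_if_eq) (simp only: 2 hom_append chord_k assms mult.assoc)
    also have "\<dots> \<preceq> g_word (act_p i False g) @ w"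
      using le_append_right[OF g_word_p[OF assms(1,2), of False]] by simp
    also have "\<dots> \<preceq> g_word (act_p j True (act_p i False g))"
      using g_word_p[of "act_p i False g" j True] assms 2 by (simp add: act_p_valid)
    finally show ?thesis .
  next
    case 3
    have "g_word g @ chord i j \<preceq> (g_word g @ inv_word w) @ p j"
      by (rule le_if_eq) (simp only: 3 hom_append k_chord assms mult.assoc)
    also have "\<dots> \<preceq> g_word (act_p i False g) @ p j"
      using le_append_right[OF g_word_p[OF assms(1,2), of False]] 3 by simp
    also have "\<dots> \<preceq> g_word (act_p j True (act_p i False g))"
      using g_word_p[of "act_p i False g" j True] assms by (simp add: act_p_valid)
    finally show ?thesis .
  qed
qed

lemma lett_chord: "\<phi> [lett (Suc j)] = tp (- n (Suc j)) * \<phi> (chord j (Suc j))"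
  by (simp add: chord_Suc hom_append hom_Nil flip: mult.assoc tp_add)

lemma inv_lett_chord: "\<phi> [inv_letter (lett (Suc j))] = \<phi> (chord (Suc j) j) * tp (n (Suc j))"
proof -
  have "chord (Suc j) j = [inv_letter (lett (Suc j))] @ letter_pow t (- n (Suc j))"
    by (simp add: inv_word_chord[of j "Suc j", symmetric] chord_Suc inv_word_Cons inv_word_letter_pow)
  then show ?thesis
    by (simp only: hom_append mult.assoc flip: tp_add) (simp add: hom_Nil)
qed

text \<open>A letter \<open>lett (Suc j)\<close> differs from \<open>chord j (Suc j)\<close> only by
  a power of \<open>t\<close>, which is a unit; bounding chords therefore suffices.\<close>

lemma g_word_x:
  assumes "valid g" "i \<le> k"
  shows "g_word g @ signed [lett i] b \<preceq> g_word (act_x i b g)"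
proof (cases i)
  case 0
  then show ?thesis
    using g_word_p[OF assms(1), of 0 b] by (cases b) (simp_all add: act_x_def)
next
  case (Suc j)
  then have jk: "j \<le> k" "Suc j \<le> k"
    using assms by auto
  show ?thesis
  proof (cases b)
    case True
    let ?g = "act_t_pow (- n (Suc j)) g"
    have "g_word g @ [lett i] \<preceq> g_word ?g @ chord j (Suc j)"
      by (rule le_if_eq) (simp add: Suc hom_append g_word_t_pow assms lett_chord mult.assoc)
    also have "\<dots> \<preceq> g_word (act_x i True g)"
      using g_word_chord[of ?g j "Suc j"] jk assms by (simp add: Suc act_x_def act_t_pow_valid)
    finally show ?thesis
      using True by simp
  next
    case False
    let ?g = "act_p j True (act_p (Suc j) False g)"
    have "g_word g @ [inv_letter (lett i)] \<preceq> (g_word g @ chord (Suc j) j) @ letter_pow t (n (Suc j))"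
      by (rule le_if_eq) (simp add: Suc hom_append inv_lett_chord mult.assoc)
    also have "\<dots> \<preceq> g_word ?g @ letter_pow t (n (Suc j))"
      using jk assms by (intro le_append_right g_word_chord) auto
    also have "\<dots> \<preceq> g_word (act_x i False g)"
      by (rule le_if_eq) (simp add: Suc act_x_def hom_append g_word_t_pow act_p_valid assms)
    finally show ?thesis
      using False by (simp add: inv_word_Cons)
  qed
qed

lemma letter_cases:
  assumes "fst a \<in> Y"
  obtains (t) b where "a = (t, b)" "act a = act_t b"
  | (x) i b where "i \<le> k" "[a] = signed [lett i] b" "act a = act_x i b"
  | (other) "[a] = f_word (k + c (fst a), snd a)" "act a = push (k + c (fst a), snd a)"
proof (cases "fst a \<in> x ` {..k}")
  case True
  then obtain i where i: "i \<le> k" "fst a = x i"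
    by auto
  then have "a = lett i \<or> a = inv_letter (lett i)"
    by (auto simp: lett_def inv_letter_def prod_eq_iff)
  then show ?thesis
    using x[of i True] x[of i False] i(1) by (auto simp: act_lett act_inv_lett inv_word_Cons)
next
  case False
  then show ?thesis
    using t[of "snd a"] other assms f_word_letter[of "fst a" "snd a"]
    by (cases "fst a = t") (auto simp: act_def prod_eq_iff)
qed

lemma g_word_act:
  assumes "valid g" "fst a \<in> Y"
  shows "g_word g @ [a] \<preceq> g_word (act a g)"
  using assms(2)
proof (cases rule: letter_cases)
  case (t b)
  then show ?thesis
    using g_word_t[OF assms(1), of b] by (intro le_if_eq) (simp add: hom_append)
next
  case (x i b)
  then show ?thesis
    using g_word_x[OF assms(1)] by simp
next
  case other
  then show ?thesis
    using g_word_push by simp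
qed

lemma le_g_word_acts: "valid g \<Longrightarrow> u \<in> words Y \<Longrightarrow> g_word g @ u \<preceq> g_word (acts u g)"
proof (induction u arbitrary: g)
  case (Cons a u)
  have "g_word g @ a # u \<preceq> g_word (act a g) @ u"
    using le_append_right[OF g_word_act[OF Cons.prems(1), of a], of u] Cons.prems by simp
  also have "\<dots> \<preceq> g_word (acts (a # u) g)"
    using Cons.IH[OF act_valid[OF Cons.prems(1)]] Cons.prems by simp
  finally show ?case .
qed simp

lemma g_word_p_fresh:
  assumes "valid g" "snd g = []" "i \<le> k"
  shows "\<phi> (g_word (act_p i b g)) = \<phi> (g_word g) * \<phi> (signed (p i) b)"
proof (cases "i < k")
  case True
  with assms show ?thesis
    by (simp add: act_p_def g_word_def push_def f_word_p hom_append)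
next
  case False
  with assms show ?thesis
    by (simp add: act_p_def g_word_w)
qed

lemma g_word_chord_fresh:
  assumes "valid g" "snd g = []" "i \<le> k" "j \<le> k" "i \<noteq> j"
  shows "\<phi> (g_word (act_p j True (act_p i False g))) = \<phi> (g_word g) * \<phi> (chord i j)"
proof -
  consider "i < k" "j < k" | "j = k" "i < k" | "i = k" "j < k"
    using assms by linarith
  then show ?thesis
  proof cases
    case 1
    with assms show ?thesis
      by (simp add: act_p_def push_def g_word_def hom_append)
  next
    case 2
    then have "\<phi> (g_word (act_p j True (act_p i False g))) = \<phi> (g_word (act_p i False g)) * \<phi> w"
      using assms by (simp add: act_p_def[of k] g_word_w act_p_valid)
    also have "\<dots> = \<phi> (g_word g) * \<phi> (chord i j)"
      using assms 2 by (simp add: g_word_p_fresh chord_k mult.assoc)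
    finally show ?thesis .
  next
    case 3
    then have "snd (act_p i False g) = []"
      using assms by (simp add: act_p_def act_w_def on_top_def)
    with assms 3 show ?thesis
      by (simp add: g_word_p_fresh act_p_valid k_chord mult.assoc)
  qed
qed

lemma act_t_pow_snd: "snd (act_t_pow m g) = snd g"
proof -
  have "snd ((act_t b ^^ i) g) = snd g" for b i
    by (induction i) (auto simp: act_t_def on_top_def)
  then show ?thesis
    by (simp add: act_t_pow_def)
qed

text \<open>When the generators of a single letter act, no earlier generator is on the stack to
  cancel or merge with. So the inequalities used for general states become equalities.\<close>

lemma g_word_letter:
  assumes "fst a \<in> Y"
  shows "\<phi> (g_word (act a g_one)) = \<phi> [a]"
  using assms
proof (cases rule: letter_cases)
  case (t b)
  then show ?thesis
    using g_word_t[OF g_one_valid, of b] by (simp add: g_word_one hom_Nil)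
next
  case (x i b)
  note one = g_one_valid g_word_one hom_Nil
  have snd: "snd g_one = []"
    by (simp add: g_one_def)
  show ?thesis
  proof (cases i)
    case 0
    with x show ?thesis
      using g_word_p_fresh[OF g_one_valid snd, of 0 b] by (simp add: act_x_def one)
  next
    case (Suc j)
    then have jk: "j \<le> k" "Suc j \<le> k"
      using x by auto
    show ?thesis
    proof (cases b)
      case True
      then show ?thesis
        using x(2,3) Suc jk g_word_chord_fresh[of "act_t_pow (- n (Suc j)) g_one" j "Suc j"]
        by (simp add: act_x_def act_t_pow_valid act_t_pow_snd snd one g_word_t_pow lett_chord)
    next
      case False
      then show ?thesis
        using x(2,3) Suc jk g_word_chord_fresh[of g_one "Suc j" j]
        by (simp add: act_x_def g_word_t_pow act_p_valid snd one inv_lett_chord inv_word_Cons)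
    qed
  qed
next
  case other
  then show ?thesis
    by (simp add: push_def g_one_def g_word_def)
qed

text \<open>Both words have the same normal form, whose word lies above \<open>z\<close> and is
  equal to \<open>y\<close> for a \<open>y\<close> this short. For \<open>y = []\<close> this is
  E-unitarity: what is trivial in the group is idempotent.\<close>

lemma gp_cong_imp_le:
  assumes "(z, y) \<in> cong_gen Y (gp_rels Y r)" "length y \<le> 1"
  shows "z \<preceq> y"
proof -
  have words: "z \<in> words Y" "y \<in> words Y"
    using cong_gen_words[OF assms(1)] by auto
  have "z \<preceq> g_word (acts z g_one)"
    using le_g_word_acts[OF g_one_valid words(1)] by (simp add: g_word_one)
  also have "acts z g_one = acts y g_one"
    by (rule acts_cong[OF assms(1) g_one_valid])
  also have "\<phi> (g_word (acts y g_one)) = \<phi> y"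
    using assms(2) words(2) by (cases y) (auto simp: g_word_one g_word_letter)
  then have "g_word (acts y g_one) \<preceq> y"
    by (rule le_if_eq)
  finally show ?thesis .
qed

end

section \<open>The prefix monoid\<close>

context relator
begin

abbreviation "C \<equiv> cong_gen Y (gp_rels Y r)"
abbreviation "D \<equiv> cong_gen Y (inv_rels Y r)"

definition in_prefix_monoid :: "'a word \<Rightarrow> bool" where
  "in_prefix_monoid u \<longleftrightarrow> elem_of Y (gp_rels Y r) u \<in> prefix_monoid Y r"

lemma in_prefix_monoid_Nil: "in_prefix_monoid []"
  unfolding in_prefix_monoid_def prefix_monoid_def hull_def
  using submonoid.one_closed[of _ "Gp Y r"] by (auto simp: presented_monoid_def)

lemma in_prefix_monoid_append:
  assumes "in_prefix_monoid u" "in_prefix_monoid v" "u \<in> words Y" "v \<in> words Y"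
  shows "in_prefix_monoid (u @ v)"
  using assms submonoid.m_closed[of _ "Gp Y r"]
  unfolding in_prefix_monoid_def prefix_monoid_def hull_def by (fastforce simp flip: mult_elem_of)

lemma in_prefix_monoid_prefix: "prefix q r \<Longrightarrow> in_prefix_monoid q"
  unfolding in_prefix_monoid_def prefix_monoid_def by (rule hull_inc) simp

lemma in_prefix_monoid_cong: "(u, v) \<in> C \<Longrightarrow> in_prefix_monoid u \<longleftrightarrow> in_prefix_monoid v"
  using elem_of_eq[of Y "gp_rels Y r" u v] by (simp add: in_prefix_monoid_def)

lemma in_prefix_monoid_induct [consumes 2, case_names cong prefix Nil append]:
  assumes u: "in_prefix_monoid u" "u \<in> words Y"
    and cong: "\<And>u v. (u, v) \<in> C \<Longrightarrow> P v \<Longrightarrow> P u"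
    and pre: "\<And>q. prefix q r \<Longrightarrow> P q"
    and Nil: "P []"
    and append: "\<And>u v. u \<in> words Y \<Longrightarrow> v \<in> words Y \<Longrightarrow> P u \<Longrightarrow> P v \<Longrightarrow> P (u @ v)"
  shows "P u"
proof -
  let ?H = "elem_of Y (gp_rels Y r) ` {u \<in> words Y. P u}"
  have "submonoid ?H (Gp Y r)"
  proof
    show "?H \<subseteq> carrier (Gp Y r)"
      by (auto simp: carrier_presented_monoid)
    show "\<one>\<^bsub>Gp Y r\<^esub> \<in> ?H"
      using Nil by (auto simp: presented_monoid_def)
    fix a b assume "a \<in> ?H" "b \<in> ?H"
    then obtain u v where "u \<in> words Y" "v \<in> words Y" "P u" "P v"
      "a = elem_of Y (gp_rels Y r) u" "b = elem_of Y (gp_rels Y r) v"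
      by auto
    then show "a \<otimes>\<^bsub>Gp Y r\<^esub> b \<in> ?H"
      using append by (auto simp: mult_elem_of)
  qed
  moreover have "q \<in> words Y" if "prefix q r" for q
    using that r_words by (auto elim!: prefixE)
  then have "elem_of Y (gp_rels Y r) ` {q. prefix q r} \<subseteq> ?H"
    using pre by auto
  ultimately have "prefix_monoid Y r \<subseteq> ?H"
    unfolding prefix_monoid_def by (intro hull_minimal)
  with u(1) obtain v where "P v" "elem_of Y (gp_rels Y r) u = elem_of Y (gp_rels Y r) v"
    by (auto simp: in_prefix_monoid_def)
  then show ?thesis
    using cong u(2) by (auto simp: elem_of_eq)
qed

text \<open>Only the free generators are tested, since the whole subgroup generated by
  \<open>w\<close> and \<open>t\<close> lies in the prefix monoid.\<close>

definition positive :: "gstate \<Rightarrow> bool" where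
  "positive g \<longleftrightarrow> (\<forall>f\<in>fst ` set (snd g). fst f < k \<and> snd f)"

lemma positive_act_t: "positive g \<Longrightarrow> positive (act_t b g)"
  by (simp add: positive_def act_t_def on_top_def)

lemma positive_acts_t: "positive g \<Longrightarrow> \<forall>a\<in>set u. fst a = t \<Longrightarrow> positive (acts u g)"
  by (induction u arbitrary: g) (auto simp: act_def positive_act_t)

text \<open>On a positive stack a positive generator meets no inverse, so it never cancels.\<close>

lemma positive_act_p: "positive g \<Longrightarrow> positive (act_p i True g)"
  by (auto simp: positive_def act_p_def act_w_def on_top_def push_def split: list.splits if_splits)

text \<open>The induction follows the prefixes \<open>p j\<close>, not the letters:
  \<open>lett (Suc j)\<close> acts through the inverse of \<open>p j\<close>, which disappears only
  because \<open>p j\<close> has been read in full before.\<close>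

lemma positive_acts_prefix_p:
  "prefix q (p j) \<Longrightarrow> j \<le> k \<Longrightarrow> valid g \<Longrightarrow> positive g \<Longrightarrow> positive (acts q g)"
proof (induction j arbitrary: q)
  case 0
  then show ?case
    using acts_p[of 0 g] by (auto simp: prefix_Cons positive_act_p)
next
  case (Suc j)
  let ?u = "letter_pow t (n (Suc j))"
  from Suc.prems(1) consider "prefix q (p j)" | v where "q = p j @ v" "prefix v ?u" | "q = p (Suc j)"
    by (auto simp: prefix_append prefix_Cons)
  then show ?case
  proof cases
    case 1
    then show ?thesis
      using Suc by simp
  next
    case (2 v)
    then have "\<forall>a\<in>set v. fst a = t"
      using set_mono_prefix[of v ?u] by (auto simp: letter_pow_def)
    then show ?thesis
      using Suc.prems 2 positive_act_p positive_acts_t by (auto simp: acts_p)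
  next
    case 3
    then show ?thesis
      using Suc.prems acts_p[of "Suc j" g] positive_act_p by (simp del: p.simps)
  qed
qed

lemma positive_acts_prefix_r:
  assumes "prefix q r" "valid g" "positive g"
  shows "positive (acts q g)"
proof -
  let ?u = "letter_pow t (- 2 * s)"
  have w: "valid (acts w g)" "positive (acts w g)"
    using assms positive_acts_prefix_p[of w k g] by (auto simp: acts_valid)
  have t: "\<forall>a\<in>set v. fst a = t" if "prefix v ?u" for v
    using set_mono_prefix[OF that] by (auto simp: letter_pow_def)
  from assms(1) consider "prefix q w" | v where "q = w @ v" "prefix v ?u"
    | v where "q = w @ ?u @ v" "prefix v w"
    unfolding r_def prefix_append by fastforce
  then show ?thesis
  proof cases
    case 1
    then show ?thesis
      using assms positive_acts_prefix_p by blast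
  next
    case (2 v)
    then show ?thesis
      using positive_acts_t[OF w(2) t] by simp
  next
    case (3 v)
    then show ?thesis
      using positive_acts_t[OF w(2) t[of ?u]] positive_acts_prefix_p[of v k "acts ?u (acts w g)"] w
      by (simp add: acts_valid)
  qed
qed

lemma in_prefix_monoid_positive:
  assumes "in_prefix_monoid u" "u \<in> words Y" "valid g" "positive g"
  shows "positive (acts u g)"
  using assms
proof (induction u arbitrary: g rule: in_prefix_monoid_induct)
  case (cong u v)
  then show ?case
    using acts_cong by simp
qed (auto simp: positive_acts_prefix_r acts_valid)

interpretation M: relator_hom X t k x \<epsilon> n s c "quot Y (inv_rels Y r)"
proof (intro relator_hom.intro relator_hom_axioms.intro relator_axioms quot_inv)
  have "(r, []) \<in> D"
    by (intro cong_gen.base r_words) (auto simp: inv_rels_def)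
  then show "quot Y (inv_rels Y r) r = 1"
    using quot_eqI[of r "[]"] by (simp add: quot_Nil)
qed

abbreviation \<phi> :: "'a word \<Rightarrow> 'a word set endo" where
  "\<phi> \<equiv> quot Y (inv_rels Y r)"

abbreviation \<gamma> :: "'a word \<Rightarrow> 'a word set endo" where
  "\<gamma> \<equiv> quot Y (gp_rels Y r)"

lemma hom_eq_imp_C: "\<phi> u = \<phi> v \<Longrightarrow> u \<in> words Y \<or> v \<in> words Y \<Longrightarrow> (u, v) \<in> C"
  by (intro inv_cong_imp_gp_cong quot_eqD)

lemma C_iff: "u \<in> words Y \<Longrightarrow> (u, v) \<in> C \<longleftrightarrow> \<gamma> u = \<gamma> v"
  using quot_eqI[of u v Y "gp_rels Y r"] quot_eqD[of Y "gp_rels Y r" u v] by auto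

lemma gp_inverse: "u \<in> words Y \<Longrightarrow> \<gamma> u * (\<gamma> (inv_word u) * a) = a" "u \<in> words Y \<Longrightarrow> \<gamma> (inv_word u) * (\<gamma> u * a) = a"
  using quot_gp_cancel[of u Y r] quot_gp_cancel[of "inv_word u" Y r] by (simp_all flip: mult.assoc)

text \<open>An inequality in M becomes an equality in G, where \<open>u @ inv_word u\<close> is
  trivial.\<close>

lemma C_g_word:
  assumes "u \<in> words Y"
  shows "(u, g_word (acts u g_one)) \<in> C"
proof -
  let ?v = "g_word (acts u g_one)"
  have "M.le u ?v"
    using M.le_g_word_acts[OF g_one_valid assms] by (simp add: g_word_one)
  then have "\<phi> u = \<phi> (u @ inv_word u @ ?v)"
    by (simp add: M.le_def quot_append)
  then have C: "(u, (u @ inv_word u) @ ?v) \<in> C"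
    using hom_eq_imp_C assms by simp
  then have "((u @ inv_word u) @ ?v, [] @ ?v) \<in> C"
    using cong_gen_words[OF C] by (intro cong_gen.mult gp_cancel cong_gen.refl) auto
  with C show ?thesis
    using cong_gen.trans by fastforce
qed

lemma in_prefix_monoid_p: "j \<le> k \<Longrightarrow> in_prefix_monoid (p j)"
  using prefixI[OF p_chord[of j k, symmetric]]
  by (intro in_prefix_monoid_prefix) (simp add: r_def prefix_prefix)

lemma in_prefix_monoid_inv_w: "in_prefix_monoid (inv_word w)"
proof -
  \<comment> \<open>This prefix of the relator is equal to the inverse of \<open>w\<close>, already
    in M.\<close>
  let ?v = "w @ letter_pow t (- 2 * s)"
  have "prefix ?v r"
    by (simp add: r_def)
  then have "in_prefix_monoid ?v"
    by (rule in_prefix_monoid_prefix)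
  moreover have "\<phi> ?v = \<phi> (inv_word w)"
  proof -
    have "\<phi> ?v = \<phi> ?v * \<phi> w * \<phi> (inv_word w)"
      using M.w_inverse by (simp only: mult.assoc mult_1_right)
    also have "\<dots> = (\<phi> w * (M.tp (- 2 * s) * \<phi> w)) * \<phi> (inv_word w)"
      by (simp only: quot_append mult.assoc)
    finally show ?thesis
      by (simp only: M.w_tp_w mult_1_left)
  qed
  then have "(?v, inv_word w) \<in> C"
    by (rule hom_eq_imp_C) (simp add: p_words)
  ultimately show ?thesis
    using in_prefix_monoid_cong by blast
qed

lemma in_prefix_monoid_letter_pow: "in_prefix_monoid (letter_pow t m)"
proof -
  define b where "b = (0 \<le> - 2 * s)"
  \<comment> \<open>The sign opposite to \<open>b\<close>. As t^(2s) = w^2, the power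
    \<open>e\<close> of \<open>t\<close> is \<open>w @ w\<close> times the power
    \<open>e - 2 * s\<close>, whose exponent has the sign of \<open>- 2 * s\<close>; it is a power
    of the letter obtained first.\<close>
  define e :: int where "e = (if b then - 1 else 1)"
  have rep: "in_prefix_monoid (replicate i (t, b'))" if "in_prefix_monoid [(t, b')]" for i b'
  proof (induction i)
    case (Suc i)
    then show ?case
      using in_prefix_monoid_append[OF that Suc] by (simp add: words_def in_lists_conv_set)
  qed (simp add: in_prefix_monoid_Nil)
  have w: "in_prefix_monoid w" "w \<in> words Y"
    by (simp_all add: in_prefix_monoid_p p_words)
  have "nat \<bar>- 2 * s\<bar> \<noteq> 0"
    using s_nonzero by simp
  then have "prefix (w @ [(t, b)]) r"
    unfolding r_def letter_pow_def b_def by (cases "nat \<bar>- 2 * s\<bar>") auto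
  then have "in_prefix_monoid (inv_word w @ w @ [(t, b)])"
    using w by (intro in_prefix_monoid_append in_prefix_monoid_inv_w in_prefix_monoid_prefix) auto
  moreover have "(inv_word w @ w @ [(t, b)], [(t, b)]) \<in> C"
    using w by (subst C_iff) (auto simp: quot_append gp_inverse)
  ultimately have t: "in_prefix_monoid [(t, b)]"
    using in_prefix_monoid_cong by blast
  have "\<phi> (w @ w @ letter_pow t (e - 2 * s)) = \<phi> (letter_pow t e)"
    using M.w_square M.tp_add[of "2 * s" "e - 2 * s"] by (simp add: quot_append flip: mult.assoc)
  then have "(w @ w @ letter_pow t (e - 2 * s), letter_pow t e) \<in> C"
    using w by (intro hom_eq_imp_C) (auto simp: words_letter_pow)
  moreover have "letter_pow t (e - 2 * s) = replicate (nat \<bar>e - 2 * s\<bar>) (t, b)"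
    using s_nonzero by (auto simp: letter_pow_def e_def b_def)
  then have "in_prefix_monoid (w @ w @ letter_pow t (e - 2 * s))"
    using w rep[OF t] by (intro in_prefix_monoid_append) (auto simp: words_def in_lists_conv_set)
  ultimately have "in_prefix_monoid (letter_pow t e)"
    using in_prefix_monoid_cong by blast
  moreover have "letter_pow t e = [(t, \<not> b)]"
    by (auto simp: letter_pow_def e_def)
  ultimately have "in_prefix_monoid [(t, b')]" for b'
    using t by (cases "b' = b") auto
  then show ?thesis
    unfolding letter_pow_def by (rule rep)
qed

lemma syll_word_words: "syll_word l \<in> words Y"
  by (induction l) (auto simp: p_words words_letter_pow)

lemma in_prefix_monoid_h_word: "in_prefix_monoid (h_word h)"
proof -
  have "in_prefix_monoid (syll_word l)" for l
    by (induction l) (auto intro!: in_prefix_monoid_append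
        simp: in_prefix_monoid_Nil in_prefix_monoid_p in_prefix_monoid_letter_pow
          p_words words_letter_pow syll_word_words)
  then show ?thesis
    unfolding h_word_def
    by (intro in_prefix_monoid_append in_prefix_monoid_letter_pow words_letter_pow syll_word_words) simp_all
qed

lemma h_word_words: "h_word h \<in> words Y"
  by (simp add: h_word_def words_letter_pow syll_word_words)

lemma in_prefix_monoid_st_word:
  "\<forall>f\<in>fst ` set st. fst f < k \<and> snd f \<Longrightarrow> st_word st \<in> words Y \<and> in_prefix_monoid (st_word st)"
proof (induction st)
  case (Cons a st)
  obtain i h where a: "a = ((i, True), h)" and i: "i < k"
    using Cons.prems by (cases a) auto
  have st: "st_word st \<in> words Y" "in_prefix_monoid (st_word st)"
    using Cons by auto
  have "st_word (a # st) = st_word st @ h_word h @ p i"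
  proof (cases rule: st_word_cases[where st = st and h = h and f = "(i, True)"])
    case (chord f' h' st')
    then show ?thesis
      using Cons.prems by simp
  next
    case simple
    then show ?thesis
      by (simp only: a f_word_p i if_True)
  qed
  then show ?case
    using st i by (auto intro!: in_prefix_monoid_append
        simp: in_prefix_monoid_h_word in_prefix_monoid_p h_word_words p_words)
qed (simp add: in_prefix_monoid_Nil)

lemma in_prefix_monoid_iff:
  assumes "u \<in> words Y"
  shows "in_prefix_monoid u \<longleftrightarrow> positive (acts u g_one)"
proof
  assume "positive (acts u g_one)"
  then have "in_prefix_monoid (g_word (acts u g_one))"
    unfolding g_word_def positive_def
    by (intro in_prefix_monoid_append) (simp_all add: in_prefix_monoid_st_word in_prefix_monoid_h_word h_word_words)
  then show "in_prefix_monoid u"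
    using in_prefix_monoid_cong[OF C_g_word[OF assms]] by simp
next
  have "positive g_one"
    by (simp add: positive_def g_one_def)
  then show "in_prefix_monoid u \<Longrightarrow> positive (acts u g_one)"
    using in_prefix_monoid_positive[OF _ assms g_one_valid] by simp
qed

lemma C_iff_acts:
  assumes "u \<in> words Y" "v \<in> words Y"
  shows "(u, v) \<in> C \<longleftrightarrow> acts u g_one = acts v g_one"
proof
  assume "acts u g_one = acts v g_one"
  then show "(u, v) \<in> C"
    using C_g_word[OF assms(1)] C_g_word[OF assms(2)] by (metis cong_gen.sym cong_gen.trans)
qed (rule acts_cong[OF _ g_one_valid])

section \<open>The word problem of the inverse monoid\<close>

text \<open>
  The elements represented by the prefixes of \<open>u\<close>, multiplied by the prefix monoid, are the
  vertices of the Schuetzenberger graph of \<open>u\<close>.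
\<close>

definition covered :: "'a word \<Rightarrow> 'a word \<Rightarrow> bool" where
  "covered u v \<longleftrightarrow> (\<forall>u'. prefix u' u \<longrightarrow> (\<exists>v'. prefix v' v \<and> in_prefix_monoid (inv_word v' @ u')))"

lemma prefix_words: "prefix u' u \<Longrightarrow> u \<in> words Y \<Longrightarrow> u' \<in> words Y"
  by (auto elim!: prefixE)

lemma coveredI:
  assumes "u \<in> words Y" "\<And>u'. prefix u' u \<Longrightarrow> \<exists>v'. prefix v' v \<and> \<gamma> u' = \<gamma> v'"
  shows "covered u v"
  unfolding covered_def
proof (intro allI impI)
  fix u' assume u': "prefix u' u"
  then obtain v' where v': "prefix v' v" "\<gamma> u' = \<gamma> v'"
    using assms(2) by blast
  have "u' \<in> words Y"
    using prefix_words[OF u' assms(1)] .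
  moreover from this have "v' \<in> words Y"
    using v'(2) C_iff cong_gen_words by blast
  ultimately have "(inv_word v' @ u', []) \<in> C"
    using gp_inverse(2)[of v' 1] v'(2) by (subst C_iff) (auto simp: quot_append quot_Nil)
  then show "\<exists>v'. prefix v' v \<and> in_prefix_monoid (inv_word v' @ u')"
    using v'(1) in_prefix_monoid_cong in_prefix_monoid_Nil by blast
qed

lemma covered_refl: "u \<in> words Y \<Longrightarrow> covered u u"
  by (rule coveredI) auto

lemma covered_trans:
  assumes "covered u v" "covered v z" "u \<in> words Y" "v \<in> words Y" "z \<in> words Y"
  shows "covered u z"
  unfolding covered_def
proof (intro allI impI)
  fix u' assume u': "prefix u' u"
  then obtain v' where v': "prefix v' v" "in_prefix_monoid (inv_word v' @ u')"
    using assms by (auto simp: covered_def)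
  then obtain z' where z': "prefix z' z" "in_prefix_monoid (inv_word z' @ v')"
    using assms by (auto simp: covered_def)
  have words: "u' \<in> words Y" "v' \<in> words Y" "z' \<in> words Y"
    using u' v' z' assms prefix_words by auto
  then have "in_prefix_monoid ((inv_word z' @ v') @ (inv_word v' @ u'))"
    using v'(2) z'(2) by (intro in_prefix_monoid_append[of "_ @ _"]) auto
  moreover have "((inv_word z' @ v') @ (inv_word v' @ u'), inv_word z' @ u') \<in> C"
    using words by (subst C_iff) (auto simp: quot_append gp_inverse mult.assoc)
  ultimately show "\<exists>z'. prefix z' z \<and> in_prefix_monoid (inv_word z' @ u')"
    using z' in_prefix_monoid_cong by blast
qed

text \<open>The vertices of a second factor are translated by the first, so \<open>u\<close> and
  \<open>v\<close> must have the same value in G for the translates to be comparable.\<close>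

lemma covered_append:
  assumes uv: "(u, v) \<in> C" and "covered u v" "covered u' v'" "u' \<in> words Y" "v' \<in> words Y"
  shows "covered (u @ u') (v @ v')"
  unfolding covered_def
proof (intro allI impI)
  fix q assume "prefix q (u @ u')"
  then consider "prefix q u" | q' where "q = u @ q'" "prefix q' u'"
    by (auto simp: prefix_append)
  then show "\<exists>q'. prefix q' (v @ v') \<and> in_prefix_monoid (inv_word q' @ q)"
  proof cases
    case 1
    then obtain q' where "prefix q' v" "in_prefix_monoid (inv_word q' @ q)"
      using assms(2) by (auto simp: covered_def)
    then show ?thesis
      using prefix_prefix by blast
  next
    case (2 q')
    then obtain z where z: "prefix z v'" "in_prefix_monoid (inv_word z @ q')"
      using assms by (auto simp: covered_def)
    have "u \<in> words Y" "v \<in> words Y" "q' \<in> words Y" "z \<in> words Y" "\<gamma> u = \<gamma> v"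
      using cong_gen_words[OF uv] prefix_words assms 2 z C_iff[of u v] by auto
    then have "(inv_word (v @ z) @ q, inv_word z @ q') \<in> C"
      using 2 by (subst C_iff) (auto simp: quot_append gp_inverse mult.assoc)
    then show ?thesis
      using z in_prefix_monoid_cong[of "inv_word (v @ z) @ q" "inv_word z @ q'"]
      by (intro exI[of _ "v @ z"]) auto
  qed
qed

text \<open>Reading the inverse of \<open>u\<close> after \<open>u\<close> retraces the path, so no
  new vertex is visited.\<close>

lemma prefix_inv_word:
  assumes "prefix q (u @ inv_word u)" "u \<in> words Y"
  shows "\<exists>u'. prefix u' u \<and> \<gamma> q = \<gamma> u'"
proof -
  from assms(1) consider "prefix q u" | q' where "q = u @ q'" "prefix q' (inv_word u)"
    by (auto simp: prefix_append)
  then show ?thesis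
  proof cases
    case (2 q')
    then obtain z where z: "inv_word u = q' @ z"
      by (auto elim: prefixE)
    then have u: "u = inv_word z @ inv_word q'"
      using inv_word_inv_word[of u] by simp
    then have "q' \<in> words Y"
      using assms(2) by simp
    then have "\<gamma> q = \<gamma> (inv_word z)"
      using 2(1) u gp_inverse(2)[of q' 1] by (simp add: quot_append mult.assoc)
    with u show ?thesis
      by (intro exI[of _ "inv_word z"]) simp
  qed auto
qed

lemma prefix_idem_append:
  assumes "prefix q (u @ inv_word u @ v)" "u \<in> words Y"
  shows "\<exists>q'. (prefix q' u \<or> prefix q' v) \<and> \<gamma> q = \<gamma> q'"
proof -
  have "prefix q ((u @ inv_word u) @ v)"
    using assms(1) by simp
  then consider "prefix q (u @ inv_word u)" | q' where "q = (u @ inv_word u) @ q'" "prefix q' v"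
    unfolding prefix_append by blast
  then show ?thesis
  proof cases
    case 1
    then show ?thesis
      using prefix_inv_word assms(2) by blast
  next
    case (2 q')
    then show ?thesis
      using assms(2) by (intro exI[of _ q']) (auto simp: quot_append gp_inverse mult.assoc)
  qed
qed

lemma covered_commute:
  assumes "u \<in> words Y" "v \<in> words Y"
  shows "covered (u @ inv_word u @ v @ inv_word v) (v @ inv_word v @ u @ inv_word u)"
proof (rule coveredI)
  show "u @ inv_word u @ v @ inv_word v \<in> words Y"
    using assms by simp
  fix q assume "prefix q (u @ inv_word u @ v @ inv_word v)"
  then obtain q' where q': "prefix q' u \<or> prefix q' (v @ inv_word v)" "\<gamma> q = \<gamma> q'"
    using prefix_idem_append assms by blast
  show "\<exists>q'. prefix q' (v @ inv_word v @ u @ inv_word u) \<and> \<gamma> q = \<gamma> q'"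
    using q'(1)
  proof
    assume "prefix q' u"
    then have "prefix (v @ inv_word v @ q') (v @ inv_word v @ u @ inv_word u)"
      by (simp add: prefix_prefix)
    moreover have "\<gamma> q = \<gamma> (v @ inv_word v @ q')"
      using q' assms by (simp add: quot_append gp_inverse)
    ultimately show ?thesis
      by blast
  next
    assume "prefix q' (v @ inv_word v)"
    then have "prefix q' (v @ inv_word v @ u @ inv_word u)"
      using prefix_prefix[of q' "v @ inv_word v" "u @ inv_word u"] by simp
    with q' show ?thesis
      by blast
  qed
qed

lemma covered_if_D:
  assumes "(u, v) \<in> D"
  shows "covered u v \<and> covered v u"
  using assms
proof induction
  case (base u v)
  from base(1) consider (reg) "u = v @ inv_word v @ v" | (comm) x y where
      "u = x @ inv_word x @ y @ inv_word y" "v = y @ inv_word y @ x @ inv_word x"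
    | (rel) "u = r" "v = []"
    by (auto simp: inv_rels_def)
  then show ?case
  proof cases
    case reg
    have "covered v u"
      using base(3) unfolding reg by (intro coveredI) (auto intro: prefix_prefix)
    moreover have "covered u v"
      using base prefix_idem_append[of _ v v] unfolding reg by (intro coveredI) auto
    ultimately show ?thesis
      by simp
  next
    case comm
    then show ?thesis
      using base covered_commute by auto
  next
    case rel
    \<comment> \<open>Every prefix of \<open>r\<close> lies in the prefix monoid, so its vertex is
      the root.\<close>
    have "covered r []"
      by (auto simp: covered_def in_prefix_monoid_prefix)
    moreover have "covered [] r"
      by (auto simp: covered_def in_prefix_monoid_Nil intro!: exI[of _ "[]"])
    ultimately show ?thesis
      using rel by simp
  qed
next
  case (trans u v z)
  then show ?case
    using covered_trans cong_gen_words by meson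
next
  case (mult u v u' v')
  then have "(u, v) \<in> C" "(v, u) \<in> C" "u' \<in> words Y" "v' \<in> words Y"
    using inv_cong_imp_gp_cong cong_gen.sym cong_gen_words by meson+
  with mult.IH show ?case
    by (simp add: covered_append)
qed (auto simp: covered_refl)

text \<open>A prefix of the relator is a right unit of M, and right units are closed under products.
  The passage from \<open>u\<close> to \<open>v\<close> is forced, since equality in G does not
  preserve being a right unit of M.\<close>

lemma in_prefix_monoid_right_unit:
  assumes "in_prefix_monoid u" "u \<in> words Y"
  shows "\<exists>v. (u, v) \<in> C \<and> \<phi> v * \<phi> (inv_word v) = 1"
  using assms
proof (induction u rule: in_prefix_monoid_induct)
  case (cong u v)
  then show ?case
    using cong_gen.trans by meson
next
  case (prefix q)
  then obtain z where z: "r = q @ z"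
    by (auto elim: prefixE)
  then have "\<phi> q * \<phi> z = 1"
    using M.hom_r by (simp add: quot_append)
  moreover have "(q, q) \<in> C"
    using z r_words by (intro cong_gen.refl) simp
  ultimately show ?case
    using M.right_unit by blast
next
  case Nil
  show ?case
    by (rule exI[of _ "[]"]) (simp add: quot_Nil cong_gen.refl)
next
  case (append u v)
  then obtain u' v' where u': "(u, u') \<in> C" "\<phi> u' * \<phi> (inv_word u') = 1"
    and v': "(v, v') \<in> C" "\<phi> v' * \<phi> (inv_word v') = 1"
    by blast
  have "\<phi> (u' @ v') * \<phi> (inv_word (u' @ v')) = \<phi> u' * (\<phi> v' * \<phi> (inv_word v')) * \<phi> (inv_word u')"
    by (simp add: quot_append mult.assoc)
  also have "\<dots> = 1"
    using u' v' by simp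
  finally show ?case
    using u' v' cong_gen.mult by blast
qed

lemma prefix_idem:
  assumes "prefix v' v"
  shows "\<phi> v' * (\<phi> (inv_word v') * (\<phi> v * a)) = \<phi> v * a"
proof -
  obtain z where "v = v' @ z"
    using assms by (auto elim: prefixE)
  then show ?thesis
    by (simp add: quot_append mult.assoc M.regular_left)
qed

text \<open>
  One letter at a time: if \<open>u\<close> can be read from the root of the Schuetzenberger graph of \<open>v\<close> and
  the vertex of \<open>u y\<close> lies in it, then the label of a path between the two vertices is below \<open>y\<close>
  by maximality of \<open>y\<close>, so the edge \<open>y\<close> itself is in the graph.
\<close>

lemma covered_idem:
  assumes "covered u v" "u \<in> words Y" "v \<in> words Y"
  shows "\<phi> v * (\<phi> (inv_word v) * (\<phi> u * \<phi> (inv_word u))) = \<phi> v * \<phi> (inv_word v)"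
  using assms
proof (induction u rule: rev_induct)
  case (snoc y u)
  have u: "u \<in> words Y" "[y] \<in> words Y"
    using snoc.prems by auto
  have "covered u v"
    using snoc.prems(1) unfolding covered_def by (auto intro: prefix_prefix)
  then have IH: "\<phi> v * (\<phi> (inv_word v) * (\<phi> u * \<phi> (inv_word u))) = \<phi> v * \<phi> (inv_word v)"
    using snoc.IH u snoc.prems by blast
  obtain v' where v': "prefix v' v" "in_prefix_monoid (inv_word v' @ u @ [y])"
    using snoc.prems(1) unfolding covered_def by auto
  have "v' \<in> words Y"
    using v'(1) snoc.prems(3) by (rule prefix_words)
  then obtain q where q: "(inv_word v' @ u @ [y], q) \<in> C" "\<phi> q * \<phi> (inv_word q) = 1"
    using in_prefix_monoid_right_unit[OF v'(2)] u by auto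
  have q': "\<phi> q * (\<phi> (inv_word q) * a) = a" for a
    using q(2) by (simp flip: mult.assoc)
  \<comment> \<open>From the vertex of \<open>u\<close>: back to the root, along \<open>v\<close>
    and back, out to \<open>v'\<close>, then along \<open>q\<close>. The value in G is that of
    \<open>y\<close>, and the detour along \<open>v\<close> makes the idempotent of \<open>z\<close>
    the conjugate by \<open>u\<close> of that of \<open>v\<close>.\<close>
  define z where "z = inv_word u @ v @ inv_word v @ v' @ q"
  have "q \<in> words Y"
    using cong_gen_words[OF q(1)] by simp
  moreover have "\<gamma> q = \<gamma> (inv_word v' @ u @ [y])"
    using C_iff[of "inv_word v' @ u @ [y]" q] q(1) cong_gen_words[OF q(1)] by simp
  ultimately have "(z, [y]) \<in> C"
    using u snoc.prems(3) \<open>v' \<in> words Y\<close>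
    by (subst C_iff) (auto simp: z_def quot_append gp_inverse)
  then have "M.le z [y]"
    by (rule M.gp_cong_imp_le) simp
  then have z: "\<phi> z = \<phi> z * (\<phi> (inv_word z) * \<phi> [y])"
    by (simp add: M.le_def)
  \<comment> \<open>The right unit \<open>q\<close> drops out, and the idempotent of
    \<open>v'\<close> is absorbed by that of \<open>v\<close>, of which \<open>v'\<close> is a
    prefix.\<close>
  have "\<phi> z * \<phi> (inv_word z) = \<phi> (inv_word u) * (\<phi> v * (\<phi> (inv_word v) *
      (\<phi> v' * (\<phi> (inv_word v') * (\<phi> v * (\<phi> (inv_word v) * \<phi> u))))))"
    by (simp add: z_def quot_append mult.assoc q')
  also have "\<dots> = \<phi> (inv_word u) * (\<phi> v * (\<phi> (inv_word v) * \<phi> u))"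
    by (simp add: prefix_idem[OF v'(1)] M.regular_left)
  finally have zz: "\<phi> z * \<phi> (inv_word z) = \<phi> (inv_word u) * (\<phi> v * (\<phi> (inv_word v) * \<phi> u))" .
  let ?y = "\<phi> [y] * \<phi> (inv_word [y])"
  \<comment> \<open>An element below \<open>y\<close> is fixed by the idempotent of
    \<open>y\<close>; this is what adds the edge \<open>y\<close> to the graph.\<close>
  have "?y * \<phi> z = ?y * (\<phi> z * (\<phi> (inv_word z) * \<phi> [y]))"
    using z by simp
  also have "\<dots> = \<phi> z * (\<phi> (inv_word z) * (?y * \<phi> [y]))"
    by (simp only: mult.assoc M.idem_commute_left)
  also have "\<dots> = \<phi> z"
    using z by (simp only: mult.assoc M.regular)
  finally have yz: "?y * \<phi> z = \<phi> z" .
  have E: "\<phi> v * (\<phi> (inv_word v) * \<phi> u) = \<phi> u * (\<phi> z * \<phi> (inv_word z))"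
  proof -
    have "\<phi> u * (\<phi> z * \<phi> (inv_word z)) = \<phi> v * (\<phi> (inv_word v) * (\<phi> u * (\<phi> (inv_word u) * \<phi> u)))"
      by (simp add: zz M.idem_commute_left)
    then show ?thesis
      by (simp only: M.regular)
  qed
  have "\<phi> v * (\<phi> (inv_word v) * (\<phi> (u @ [y]) * \<phi> (inv_word (u @ [y])))) =
      (\<phi> v * (\<phi> (inv_word v) * \<phi> u)) * ?y * \<phi> (inv_word u)"
    by (simp only: quot_append inv_word_append mult.assoc)
  also have "\<dots> = \<phi> u * (\<phi> z * \<phi> (inv_word z) * ?y) * \<phi> (inv_word u)"
    by (simp only: E mult.assoc)
  also have "\<phi> z * \<phi> (inv_word z) * ?y = ?y * \<phi> z * \<phi> (inv_word z)"
    by (simp only: mult.assoc M.idem_commute[of z "[y]"])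
  also have "\<dots> = \<phi> z * \<phi> (inv_word z)"
    by (simp only: yz)
  also have "\<phi> u * (\<phi> z * \<phi> (inv_word z)) * \<phi> (inv_word u) = \<phi> v * (\<phi> (inv_word v) * (\<phi> u * \<phi> (inv_word u)))"
    by (simp only: E[symmetric] mult.assoc)
  also note IH
  finally show ?case .
qed (simp add: quot_Nil)

text \<open>Mutual covering makes the idempotents of \<open>u\<close> and \<open>v\<close> equal.
  Equality in G makes \<open>inv_word v @ u\<close> idempotent, which puts \<open>u\<close> below
  \<open>v\<close>; comparable elements with equal idempotents coincide.\<close>

lemma D_iff:
  assumes u: "u \<in> words Y" and v: "v \<in> words Y"
  shows "(u, v) \<in> D \<longleftrightarrow> (u, v) \<in> C \<and> covered u v \<and> covered v u"
proof (intro iffI conjI)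
  assume "(u, v) \<in> C \<and> covered u v \<and> covered v u"
  then have C: "(u, v) \<in> C" and "covered u v" "covered v u"
    by auto
  then have e: "\<phi> v * \<phi> (inv_word v) = \<phi> u * \<phi> (inv_word u)"
    using covered_idem[of u v] covered_idem[of v u] M.idem_commute[of u v] u v by simp
  have le: "M.le u v" if uv: "\<gamma> u = \<gamma> v" "\<phi> v * \<phi> (inv_word v) = \<phi> u * \<phi> (inv_word u)" "u \<in> words Y" "v \<in> words Y" for u v
  proof -
    have "(inv_word v @ u, []) \<in> C"
      using uv gp_inverse(2)[of v 1] by (subst C_iff) (auto simp: quot_append quot_Nil)
    then have "M.le (inv_word v @ u) []"
      by (rule M.gp_cong_imp_le) simp
    then have "M.le (v @ inv_word v @ u) v"
      using M.le_append_left[of "inv_word v @ u" "[]" v] by simp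
    moreover have "\<phi> u = \<phi> (v @ inv_word v @ u)"
      using uv(2) M.regular[of u] by (simp add: quot_append flip: mult.assoc)
    ultimately show ?thesis
      by (rule M.eq_le_trans[rotated])
  qed
  have "\<gamma> u = \<gamma> v"
    using C C_iff u by simp
  then have "M.le u v"
    using le e u v by simp
  then have "\<phi> u = (\<phi> u * \<phi> (inv_word u)) * \<phi> v"
    by (simp only: M.le_def mult.assoc)
  also have "\<dots> = \<phi> v"
    by (simp only: e[symmetric] mult.assoc M.regular)
  finally show "(u, v) \<in> D"
    using quot_eqD u by blast
qed (use covered_if_D inv_cong_imp_gp_cong in auto)

end

section \<open>Computability of the action\<close>

lemma computable_syll_w: "computable syll_w"
  unfolding syll_w_def
  by (intro computable_intros)

lemma computable_syll_t: "computable (syll_t N)"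
  unfolding syll_t_def
  by (intro computable_intros)

lemma computable_syll_t_inv: "computable (syll_t_inv N)"
  unfolding syll_t_inv_def
  by (intro computable_intros)

lemma computable_h_t: "computable (h_t N b)"
  unfolding h_t_def by (intro computable_intros computable_comp[OF computable_syll_t]
      computable_comp[OF computable_syll_t_inv])

lemma computable_h_w: "computable (h_w s b)"
proof -
  have "h_w s b = (\<lambda>h. (fst h + (if b then s else - s), syll_w (snd h)))"
    by (auto simp: h_w_def)
  then show ?thesis
    by (simp only:) (intro computable_intros computable_add_const computable_comp[OF computable_syll_w])
qed

lemma computable_on_top:
  assumes "computable F"
  shows "computable (on_top F)"
  unfolding on_top_def by (intro computable_intros computable_comp[OF assms])

lemma computable_push: "computable (push f)"
  unfolding push_def
  by (intro computable_intros)

context relator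
begin

lemma computable_act_t: "computable (act_t b)"
  unfolding act_t_def by (intro computable_on_top computable_h_t)

lemma computable_act_t_pow: "computable (act_t_pow m)"
  unfolding act_t_pow_def by (intro computable_funpow_const computable_act_t)

lemma computable_act_p: "computable (act_p i b)"
  unfolding act_p_def act_w_def by (simp add: computable_push computable_on_top computable_h_w)

lemma computable_act_x: "computable (act_x i b)"
proof (cases i)
  case 0
  then show ?thesis
    using computable_act_p by (simp add: act_x_def[abs_def])
next
  case (Suc j)
  have "computable (\<lambda>g. act_p (Suc j) True (act_p j False (act_t_pow (- n (Suc j)) g)))"
    "computable (\<lambda>g. act_t_pow (n (Suc j)) (act_p j True (act_p (Suc j) False g)))"
    by (intro computable_comp[OF computable_act_p] computable_comp[OF computable_act_t_pow]
        computable_id)+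
  with Suc show ?thesis
    by (cases b) (simp_all add: act_x_def[abs_def])
qed

lemma computable_act: "computable (act a)"
  by (simp add: act_def computable_act_t computable_act_x computable_push)

lemma computable_positive: "computable positive"
proof -
  have "positive = (\<lambda>g. list_all (\<lambda>y. fst (fst y) < k \<and> snd (fst y)) (snd g))"
    by (auto simp: positive_def list_all_iff fun_eq_iff)
  moreover have "computable (\<lambda>g :: gstate. list_all (\<lambda>y. fst (fst y) < k \<and> snd (fst y)) (snd g))"
    by (intro computable_list_all computable_intros computable_less_const)
  ultimately show ?thesis
    by simp
qed

definition code :: "'a \<times> bool \<Rightarrow> nat" where
  "code a = 2 * c (fst a) + of_bool (snd a)"

lemma inj_code: "inj_on code (Y \<times> UNIV)"
proof (rule inj_onI)
  fix a b assume ab: "a \<in> Y \<times> (UNIV :: bool set)" "b \<in> Y \<times> (UNIV :: bool set)" "code a = code b"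
  then have "snd a = snd b" "c (fst a) = c (fst b)"
    unfolding code_def by (cases "snd a"; cases "snd b"; simp; presburger)+
  moreover have "fst a \<in> Y" "fst b \<in> Y"
    using ab by (auto simp: mem_Times_iff)
  ultimately show "a = b"
    using inj_onD[OF inj_c, of "fst a" "fst b"] by (simp add: prod_eq_iff)
qed

lemma word_code_eq: "word_code c u = enc (map code u)"
proof -
  have "enc (m :: nat) = m" for m
    by (simp add: enc_nat_def)
  then have "map enc l = l" for l :: "nat list"
    by (simp add: map_idI)
  then show ?thesis
    by (simp add: word_code_def enc_list_def code_def[abs_def] case_prod_unfold del: map_map)
qed

text \<open>The program contains one routine for each letter of the finite alphabet; its behaviour
  on numbers that code no letter is arbitrary.\<close>

lemma computable_acts:
  assumes "finite X"
  shows "\<exists>R. computable R \<and> (\<forall>u\<in>words Y. R (map code u) = acts u g_one)"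
proof -
  define dec where "dec = inv_into (Y \<times> (UNIV :: bool set)) code"
  have "\<exists>G. computable (\<lambda>p. G (fst p) (snd p)) \<and> (\<forall>m\<in>code ` (Y \<times> UNIV). G m = act (dec m))"
    using assms by (intro computable_finite_cases computable_act) simp
  then obtain G where G: "computable (\<lambda>p. G (fst p) (snd p))" "\<And>m. m \<in> code ` (Y \<times> UNIV) \<Longrightarrow> G m = act (dec m)"
    by blast
  have step: "G (code a) = act a" if "fst a \<in> Y" for a
    using that inv_into_f_f[OF inj_code, of a] G(2)[of "code a"] by (simp add: dec_def mem_Times_iff)
  have "foldl (\<lambda>g m. G m g) g (map code u) = acts u g" if "u \<in> words Y" for u g
    using that by (induction u arbitrary: g) (auto simp: step)
  moreover have "computable (\<lambda>l. foldl (\<lambda>g m. G m g) g_one l)"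
  proof (rule computable_foldl)
    show "computable (\<lambda>p :: nat list \<times> gstate \<times> nat. G (snd (snd p)) (fst (snd p)))"
      using computable_comp[OF G(1), of "\<lambda>p. (snd (snd p), fst (snd p))"] by (simp add: computable_intros)
  qed (intro computable_intros)+
  ultimately show ?thesis
    by blast
qed

lemma computable_inv:
  assumes "finite X"
  shows "\<exists>I. computable I \<and> (\<forall>u\<in>words Y. I (map code u) = map code (inv_word u))"
proof -
  define dec where "dec = inv_into (Y \<times> (UNIV :: bool set)) code"
  \<comment> \<open>\<open>computable_finite_cases\<close> selects among functions, so the inverse
    letters are wrapped as constant functions; their dummy argument is later set to
    \<open>0\<close>.\<close>
  have "\<exists>J. computable (\<lambda>p :: nat \<times> nat. J (fst p) (snd p)) \<and>
      (\<forall>m\<in>code ` (Y \<times> UNIV). J m = (\<lambda>z. code (inv_letter (dec m))))"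
    using assms by (intro computable_finite_cases computable_const) simp
  then obtain J where J: "computable (\<lambda>p :: nat \<times> nat. J (fst p) (snd p))"
    "\<And>m. m \<in> code ` (Y \<times> UNIV) \<Longrightarrow> J m = (\<lambda>z. code (inv_letter (dec m)))"
    by blast
  have step: "J (code a) 0 = code (inv_letter a)" if "fst a \<in> Y" for a
    using that inv_into_f_f[OF inj_code, of a] J(2)[of "code a"] by (simp add: dec_def mem_Times_iff)
  have "rev (map (\<lambda>m. J m 0) (map code u)) = map code (inv_word u)" if "u \<in> words Y" for u
    using that by (induction u) (auto simp: step inv_word_Cons)
  moreover have "computable (\<lambda>l. rev (map (\<lambda>m. J m 0) l))"
  proof (rule computable_rev_map)
    show "computable (\<lambda>m. J m 0)"
      using computable_comp[OF J(1), of "\<lambda>m. (m, 0)"] by (simp add: computable_intros)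
  qed (rule computable_id)
  ultimately show ?thesis
    by blast
qed

section \<open>The two decision procedures\<close>

lemma prefix_membership_code:
  assumes "finite X"
  shows "\<exists>f. recursive 1 f \<and>
    (\<forall>u\<in>words Y. f [word_code c u] = (if in_prefix_monoid u then 1 else 0))"
proof -
  obtain R where R: "computable R" "\<And>u. u \<in> words Y \<Longrightarrow> R (map code u) = acts u g_one"
    using computable_acts[OF assms] by blast
  have "computable (\<lambda>l. positive (R l))"
    by (intro computable_comp[OF computable_positive] R)
  then show ?thesis
    using computable_recursive1[of "\<lambda>l. positive (R l)"] R(2) by (auto simp: word_code_eq in_prefix_monoid_iff)
qed

lemma word_problem_code:
  assumes "finite X"
  shows "\<exists>f. recursive 2 f \<and> (\<forall>u\<in>words Y. \<forall>v\<in>words Y.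
    f [word_code c u, word_code c v] = (if (u, v) \<in> D then 1 else 0))"
proof -
  obtain R where R: "computable R" "\<And>u. u \<in> words Y \<Longrightarrow> R (map code u) = acts u g_one"
    using computable_acts[OF assms] by blast
  obtain I where I: "computable I" "\<And>u. u \<in> words Y \<Longrightarrow> I (map code u) = map code (inv_word u)"
    using computable_inv[OF assms] by blast
  \<comment> \<open>Both arguments arrive reversed from \<open>rev_prefixes\<close>. The identity
    maps bring the second reversal into the form treated by
    \<open>computable_rev_map\<close>.\<close>
  define mem where "mem = (\<lambda>v u. positive (R (I (rev (map (\<lambda>x. x) v)) @ rev (map (\<lambda>x. x) u))))"
  define cov where "cov = (\<lambda>p. list_all (\<lambda>u. list_ex (\<lambda>v. mem v u) (rev_prefixes (snd p)))
    (rev_prefixes (fst p)))"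
  have mem: "computable (\<lambda>q. mem (f q) (g q))" if "computable f" "computable g"
    for f g :: "'b::encodable \<Rightarrow> nat list"
    unfolding mem_def using that
    by (intro computable_comp[OF computable_positive] computable_comp[OF R(1)] computable_append
        computable_comp[OF I(1)] computable_rev_map computable_id)
  have cov: "computable cov"
    unfolding cov_def
    by (intro computable_list_all computable_list_ex mem computable_rev_prefixes computable_intros)
  have cov_iff: "cov (map code u, map code v) \<longleftrightarrow> covered u v" if "u \<in> words Y" "v \<in> words Y" for u v
  proof -
    have mem_iff: "mem (rev (map code v')) (rev (map code u')) \<longleftrightarrow> in_prefix_monoid (inv_word v' @ u')"
      if "prefix u' u" "prefix v' v" for u' v'
    proof -
      have "u' \<in> words Y" "v' \<in> words Y"
        using that \<open>u \<in> words Y\<close> \<open>v \<in> words Y\<close> prefix_words by auto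
      then show ?thesis
        using R(2)[of "inv_word v' @ u'"] I(2)[of v'] in_prefix_monoid_iff[of "inv_word v' @ u'"]
        by (simp add: mem_def)
    qed
    have "set (rev_prefixes (map code z)) = (\<lambda>q. rev (map code q)) ` {q. prefix q z}" for z
      by (auto simp: set_rev_prefixes prefix_map_rightE map_mono_prefix image_iff elim!: prefix_map_rightE)
    then have "cov (map code u, map code v) \<longleftrightarrow> (\<forall>u'. prefix u' u \<longrightarrow>
        (\<exists>v'. prefix v' v \<and> mem (rev (map code v')) (rev (map code u'))))"
      by (auto simp: cov_def list_all_iff list_ex_iff)
    also have "\<dots> \<longleftrightarrow> covered u v"
      unfolding covered_def using mem_iff by blast
    finally show ?thesis .
  qed
  let ?P = "\<lambda>p. R (fst p) = R (snd p) \<and> cov (fst p, snd p) \<and> cov (snd p, fst p)"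
  have "computable ?P"
    by (intro computable_intros computable_comp[OF R(1)] computable_comp[OF cov])
  moreover have "?P (map code u, map code v) \<longleftrightarrow> (u, v) \<in> D" if "u \<in> words Y" "v \<in> words Y" for u v
    using that by (simp add: R(2) cov_iff D_iff C_iff_acts)
  ultimately show ?thesis
    using computable_recursive2[of ?P] by (fastforce simp: word_code_eq)
qed

end

theorem theorem5p2:
  fixes X :: "'a set" and t :: 'a and w :: "'a word"
    and k :: nat and x :: "nat \<Rightarrow> 'a" and \<epsilon> n :: "nat \<Rightarrow> int"
  assumes "finite X" and "t \<notin> X" and "w \<in> words (insert t X)"
    and "w = letter_pow (x 0) (\<epsilon> 0)
           @ concat (map (\<lambda>i. letter_pow t (n i) @ letter_pow (x i) (\<epsilon> i)) [1..<k+1])"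
    and "\<And>i. i \<le> k \<Longrightarrow> \<epsilon> i \<in> {-1, 1}"
    and "\<And>i. i \<le> k \<Longrightarrow> x i \<in> X"
    and "\<And>i j. i \<le> k \<Longrightarrow> j \<le> k \<Longrightarrow> i \<noteq> j \<Longrightarrow> x i \<noteq> x j"
    and "exp_sum t w \<noteq> 0"
  shows "prefix_membership_decidable (insert t X)
           (w @ letter_pow t (- 2 * exp_sum t w) @ w)
       \<and> word_problem_decidable (insert t X)
           (inv_rels (insert t X) (w @ letter_pow t (- 2 * exp_sum t w) @ w))"
proof -
  let ?Y = "insert t X" and ?r = "w @ letter_pow t (- 2 * exp_sum t w) @ w"
  have "\<exists>f. recursive 1 f \<and> (\<forall>u\<in>words ?Y. f [word_code c u] =
        (if elem_of ?Y (gp_rels ?Y ?r) u \<in> prefix_monoid ?Y ?r then 1 else 0))"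
    "\<exists>f. recursive 2 f \<and> (\<forall>u\<in>words ?Y. \<forall>v\<in>words ?Y. f [word_code c u, word_code c v] =
        (if (u, v) \<in> cong_gen ?Y (inv_rels ?Y ?r) then 1 else 0))"
    if "inj_on c ?Y" for c
  proof -
    interpret relator X t k x \<epsilon> n "exp_sum t w" c
      using assms that by unfold_locales auto
    have lett: "letter_pow (x i) (\<epsilon> i) = [lett i]" if "i \<le> k" for i
      using assms(5)[OF that] by (auto simp: letter_pow_def lett_def)
    \<comment> \<open>Splitting off the last block of the concatenation reproduces the recursion of
      \<open>p\<close>, so that \<open>p k\<close> is the given \<open>w\<close>.\<close>
    have "p j = letter_pow (x 0) (\<epsilon> 0)
        @ concat (map (\<lambda>i. letter_pow t (n i) @ letter_pow (x i) (\<epsilon> i)) [1..<j+1])" if "j \<le> k" for j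
      using that by (induction j) (simp_all add: lett)
    from this[of k] have "r = ?r"
      unfolding r_def by (simp only: assms(4)[symmetric] order.refl)
    then show "\<exists>f. recursive 1 f \<and> (\<forall>u\<in>words ?Y. f [word_code c u] =
        (if elem_of ?Y (gp_rels ?Y ?r) u \<in> prefix_monoid ?Y ?r then 1 else 0))"
      "\<exists>f. recursive 2 f \<and> (\<forall>u\<in>words ?Y. \<forall>v\<in>words ?Y. f [word_code c u, word_code c v] =
        (if (u, v) \<in> cong_gen ?Y (inv_rels ?Y ?r) then 1 else 0))"
      using prefix_membership_code[OF assms(1)] word_problem_code[OF assms(1)]
      by (simp_all add: in_prefix_monoid_def)
  qed
  note * = this
  have "prefix_membership_decidable ?Y ?r"
    unfolding prefix_membership_decidable_def decidable_rel_def
  proof (intro allI impI)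
    fix c :: "'a \<Rightarrow> nat" assume "inj_on c ?Y"
    from *(1)[OF this] obtain f where f: "recursive 1 f" "\<And>u. u \<in> words ?Y \<Longrightarrow> f [word_code c u] =
        (if elem_of ?Y (gp_rels ?Y ?r) u \<in> prefix_monoid ?Y ?r then 1 else 0)"
      by blast
    then show "\<exists>f. recursive 1 f \<and> (\<forall>us. length us = 1 \<and> set us \<subseteq> words ?Y \<longrightarrow> f (map (word_code c) us) =
        (if elem_of ?Y (gp_rels ?Y ?r) (us ! 0) \<in> prefix_monoid ?Y ?r then 1 else 0))"
      by (intro exI[of _ f]) (auto simp: length_Suc_conv)
  qed
  moreover have "word_problem_decidable ?Y (inv_rels ?Y ?r)"
    unfolding word_problem_decidable_def decidable_rel_def
  proof (intro allI impI)
    fix c :: "'a \<Rightarrow> nat" assume "inj_on c ?Y"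
    from *(2)[OF this] obtain f where f: "recursive 2 f"
      "\<And>u v. u \<in> words ?Y \<Longrightarrow> v \<in> words ?Y \<Longrightarrow> f [word_code c u, word_code c v] =
        (if (u, v) \<in> cong_gen ?Y (inv_rels ?Y ?r) then 1 else 0)"
      by blast
    have "f (map (word_code c) us) =
        (if elem_of ?Y (inv_rels ?Y ?r) (us ! 0) = elem_of ?Y (inv_rels ?Y ?r) (us ! 1) then 1 else 0)"
      if us: "length us = 2 \<and> set us \<subseteq> words ?Y" for us
    proof -
      obtain u v where "us = [u, v]"
        using us by (auto simp: length_Suc_conv numeral_2_eq_2)
      with us f(2)[of u v] show ?thesis
        by (simp add: elem_of_eq_iff)
    qed
    with f(1) show "\<exists>f. recursive 2 f \<and> (\<forall>us. length us = 2 \<and> set us \<subseteq> words ?Y \<longrightarrow> f (map (word_code c) us) =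
        (if elem_of ?Y (inv_rels ?Y ?r) (us ! 0) = elem_of ?Y (inv_rels ?Y ?r) (us ! 1) then 1 else 0))"
      by blast
  qed
  ultimately show ?thesis ..
qed

end
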